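(* Let $(\mathfrak{g},[~,~],\alpha)$ be a (multiplicative) Hom-Lie algebra. (i) The derived bracket $[~,~]_{\mathsf{D}}$ makes $(C^\bullet_{\mathrm{Hom}}(\mathfrak{g},\mathfrak{g}),[~,~]_{\mathsf{D}})$ into a graded Lie algebra (called the derived algebra). (ii) Moreover, the map $\theta:C^\bullet_{\mathrm{Hom}}(\mathfrak{g},\mathfrak{g})\to C^{\bullet+1}_{\mathrm{Hom}}(\mathfrak{g},\mathfrak{g})$ is a morphism of graded Lie algebras from $(C^\bullet_{\mathrm{Hom}}(\mathfrak{g},\mathfrak{g}),[~,~]_{\mathsf{D}})$ to $(C^{\bullet+1}_{\mathrm{Hom}}(\mathfrak{g},\mathfrak{g}),[~,~]_{\mathsf{NR}})$.
   Context: All vector spaces and (multi)linear maps are over a field $\mathbf{k}$ of characteristic $0$. A (multiplicative) Hom-Lie algebra $(\mathfrak{g},[~,~],\alpha)$ is a vector space $\mathfrak{g}$ with a skew-symmetric bilinear map $[~,~]$ and a linear map $\alpha:\mathfrak{g}\to\mathfrak{g}$ such that $[\alpha(x),[y,z]]+[\alpha(y),[z,x]]+[\alpha(z),[x,y]]=0$ and $\alpha([x,y])=[\alpha(x),\alpha(y)]$. For $n\ge1$, $C^n_{\mathrm{Hom}}(\mathfrak{g},\mathfrak{g})=\{f:\wedge^n\mathfrak{g}\to\mathfrak{g}\mid\alpha\circ f=f\circ\alpha^{\wedge n}\}$; $C^\bullet_{\mathrm{Hom}}(\mathfrak{g},\mathfrak{g})=\bigoplus_{n\ge1}C^n_{\mathrm{Hom}}(\mathfrak{g},\mathfrak{g})$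 with $C^n_{\mathrm{Hom}}$ in degree $n$, while in $C^{\bullet+1}_{\mathrm{Hom}}(\mathfrak{g},\mathfrak{g})$ the summand $C^{n+1}_{\mathrm{Hom}}$ has degree $n\ge0$. $Sh(m,n)$ is the set of $(m,n)$-shuffles. For $P\in C^m_{\mathrm{Hom}}(\mathfrak{g},\mathfrak{g})$, $Q\in C^n_{\mathrm{Hom}}(\mathfrak{g},\mathfrak{g})$: $$(i_PQ)(x_1,\ldots,x_{m+n-1})=\sum_{\sigma\in Sh(m,n-1)}(-1)^\sigma Q\big(P(x_{\sigma(1)},\ldots,x_{\sigma(m)}),\alpha^{m-1}x_{\sigma(m+1)},\ldots,\alpha^{m-1}x_{\sigma(m+n-1)}\big),$$ $$[P,Q]_{\mathsf{NR}}=i_PQ-(-1)^{(m-1)(n-1)}i_QP,$$ $$[P,Q]_{\mathsf{C}}(x_1,\ldots,x_{m+n})=\sum_{\sigma\in Sh(m,n)}(-1)^\sigma[\alpha^{n-1}P(x_{\sigma(1)},\ldots,x_{\sigma(m)}),\alpha^{m-1}Q(x_{\sigma(m+1)},\ldots,x_{\sigma(m+n)})].$$ The bracket $[~,~]_{\mathsf{NR}}$ makes $C^{\bullet+1}_{\mathrm{Hom}}(\mathfrak{g},\mathfrak{g})$ a graded Lie algebra. Let $\mu\in C^2_{\mathrm{Hom}}(\mathfrak{g},\mathfrak{g})$, $\mu(x,y)=[x,y]$. The map $\theta:C^n_{\mathrm{Hom}}(\mathfrak{g},\mathfrak{g})\to C^{n+1}_{\mathrm{Hom}}(\mathfrak{g},\mathfrak{g})$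 is $\theta f=-i_f\mu$, i.e. $(\theta f)(x_1,\ldots,x_{n+1})=\sum_{i=1}^{n+1}(-1)^{n+i}[f(x_1,\ldots,\widehat{x_i},\ldots,x_{n+1}),\alpha^{n-1}(x_i)]$. The derived bracket $[~,~]_{\mathsf{D}}:C^m_{\mathrm{Hom}}(\mathfrak{g},\mathfrak{g})\times C^n_{\mathrm{Hom}}(\mathfrak{g},\mathfrak{g})\to C^{m+n}_{\mathrm{Hom}}(\mathfrak{g},\mathfrak{g})$, $m,n\ge1$, is $$[P,Q]_{\mathsf{D}}:=[P,Q]_{\mathsf{C}}+i_{\theta P}Q-(-1)^{mn}i_{\theta Q}P.$$ *)

theory Defs
  imports Complex_Main "HOL-Library.Function_Algebras" "HOL-Combinatorics.Permutations"
begin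

section \<open>Graded Lie algebras and their morphisms\<close>

text \<open>
  A graded vector space is given by the family of its homogeneous components, subspaces of an
  ambient vector space indexed by degree (only non-negative degrees occur here).  The bracket is
  given on homogeneous elements: \<open>br m n\<close> is the restriction to degrees \<open>m\<close> and \<open>n\<close>, and the
  bracket of the direct sum is its bilinear extension.
\<close>

locale graded_lie_algebra = vector_space scale
  for scale :: "'k::field_char_0 \<Rightarrow> 'e::ab_group_add \<Rightarrow> 'e" (infixr \<open>*s\<close> 75) +
  fixes A :: "nat \<Rightarrow> 'e set" and br :: "nat \<Rightarrow> nat \<Rightarrow> 'e \<Rightarrow> 'e \<Rightarrow> 'e"
  assumes subspace_component: "subspace (A n)"
    and br_closed: "x \<in> A m \<Longrightarrow> y \<in> A n \<Longrightarrow> br m n x y \<in> A (m + n)"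
    and br_add_left: "x \<in> A m \<Longrightarrow> x' \<in> A m \<Longrightarrow> y \<in> A n \<Longrightarrow>
          br m n (x + x') y = br m n x y + br m n x' y"
    and br_add_right: "x \<in> A m \<Longrightarrow> y \<in> A n \<Longrightarrow> y' \<in> A n \<Longrightarrow>
          br m n x (y + y') = br m n x y + br m n x y'"
    and br_scale_left: "x \<in> A m \<Longrightarrow> y \<in> A n \<Longrightarrow> br m n (c *s x) y = c *s br m n x y"
    and br_scale_right: "x \<in> A m \<Longrightarrow> y \<in> A n \<Longrightarrow> br m n x (c *s y) = c *s br m n x y"
    and graded_skew: "x \<in> A m \<Longrightarrow> y \<in> A n \<Longrightarrow> br m n x y = - ((-1) ^ (m * n) *s br n m y x)"
    and graded_jacobi: "x \<in> A l \<Longrightarrow> y \<in> A m \<Longrightarrow> z \<in> A n \<Longrightarrow>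
          br l (m + n) x (br m n y z) =
            br (l + m) n (br l m x y) z + (-1) ^ (l * m) *s br m (l + n) y (br l n x z)"

locale graded_lie_morphism =
  source: graded_lie_algebra scaleA A brA + target: graded_lie_algebra scaleB B brB
  for scaleA :: "'k::field_char_0 \<Rightarrow> 'e::ab_group_add \<Rightarrow> 'e" and A brA
    and scaleB :: "'k \<Rightarrow> 'f::ab_group_add \<Rightarrow> 'f" and B brB +
  fixes \<phi> :: "nat \<Rightarrow> 'e \<Rightarrow> 'f"
  assumes mor_closed: "x \<in> A n \<Longrightarrow> \<phi> n x \<in> B n"
    and mor_add: "x \<in> A n \<Longrightarrow> y \<in> A n \<Longrightarrow> \<phi> n (x + y) = \<phi> n x + \<phi> n y"
    and mor_scale: "x \<in> A n \<Longrightarrow> \<phi> n (scaleA c x) = scaleB c (\<phi> n x)"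
    and mor_br: "x \<in> A m \<Longrightarrow> y \<in> A n \<Longrightarrow>
          \<phi> (m + n) (brA m n x y) = brB m n (\<phi> m x) (\<phi> n y)"

section \<open>Hom-Lie algebras\<close>

locale hom_lie_algebra = vector_space scale
  for scale :: "'k::field_char_0 \<Rightarrow> 'v::ab_group_add \<Rightarrow> 'v" (infixr \<open>*s\<close> 75) +
  fixes bracket :: "'v \<Rightarrow> 'v \<Rightarrow> 'v" and \<alpha> :: "'v \<Rightarrow> 'v"
  assumes bracket_linear_left: "Vector_Spaces.linear scale scale (\<lambda>x. bracket x y)"
    and bracket_linear_right: "Vector_Spaces.linear scale scale (\<lambda>y. bracket x y)"
    and bracket_skew: "bracket x y = - bracket y x"
    and alpha_linear: "Vector_Spaces.linear scale scale \<alpha>"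
    and hom_jacobi: "bracket (\<alpha> x) (bracket y z) + bracket (\<alpha> y) (bracket z x)
          + bracket (\<alpha> z) (bracket x y) = 0"
    and alpha_bracket: "\<alpha> (bracket x y) = bracket (\<alpha> x) (\<alpha> y)"

section \<open>Cochains\<close>

text \<open>
  A map in \<open>n\<close> arguments is encoded as a function on sequences that depends only on the entries
  \<open>0, \<dots>, n - 1\<close>; argument \<open>i + 1\<close> of the map is entry \<open>i\<close>.
  A linear map on the \<open>n\<close>-th exterior power is an alternating multilinear map in \<open>n\<close> arguments.
\<close>

type_synonym 'v cochain = "(nat \<Rightarrow> 'v) \<Rightarrow> 'v"

definition cochain_scale :: "('k \<Rightarrow> 'v \<Rightarrow> 'v) \<Rightarrow> 'k \<Rightarrow> 'v cochain \<Rightarrow> 'v cochain" where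
  "cochain_scale scale c f = (\<lambda>x. scale c (f x))"

definition hom_cochains ::
    "('k::field_char_0 \<Rightarrow> 'v::ab_group_add \<Rightarrow> 'v) \<Rightarrow> ('v \<Rightarrow> 'v) \<Rightarrow> nat \<Rightarrow> 'v cochain set" where
  "hom_cochains scale \<alpha> n = {f.
     (\<forall>x y. (\<forall>i<n. x i = y i) \<longrightarrow> f x = f y) \<and>
     (\<forall>x. \<forall>i<n. Vector_Spaces.linear scale scale (\<lambda>v. f (x(i := v)))) \<and>
     (\<forall>x. \<forall>i<n. \<forall>j<n. i \<noteq> j \<longrightarrow> x i = x j \<longrightarrow> f x = 0) \<and>
     (\<forall>x. \<alpha> (f x) = f (\<lambda>i. \<alpha> (x i)))}"

text \<open>The two gradings: \<open>C\<^sup>\<bullet>\<close> starts in degree 1, so its component of degree 0 is zero;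
  in \<open>C\<^sup>\<bullet>\<^sup>+\<^sup>1\<close> the degree is the arity minus one.\<close>

definition hom_complex ::
    "('k::field_char_0 \<Rightarrow> 'v::ab_group_add \<Rightarrow> 'v) \<Rightarrow> ('v \<Rightarrow> 'v) \<Rightarrow> nat \<Rightarrow> 'v cochain set" where
  "hom_complex scale \<alpha> n = (if n = 0 then {0} else hom_cochains scale \<alpha> n)"

definition hom_complex_shift ::
    "('k::field_char_0 \<Rightarrow> 'v::ab_group_add \<Rightarrow> 'v) \<Rightarrow> ('v \<Rightarrow> 'v) \<Rightarrow> nat \<Rightarrow> 'v cochain set" where
  "hom_complex_shift scale \<alpha> n = hom_cochains scale \<alpha> (n + 1)"

section \<open>Brackets on cochains\<close>

definition Sh :: "nat \<Rightarrow> nat \<Rightarrow> (nat \<Rightarrow> nat) set" where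
  "Sh m n = {\<sigma>. \<sigma> permutes {..<m + n} \<and>
     strict_mono_on {..<m} \<sigma> \<and> strict_mono_on {m..<m + n} \<sigma>}"

text \<open>In the operations below, the numbers \<open>m\<close> and \<open>n\<close> are the arities of \<open>P\<close> and \<open>Q\<close>.\<close>

definition insertion ::
    "('k::field_char_0 \<Rightarrow> 'v::ab_group_add \<Rightarrow> 'v) \<Rightarrow> ('v \<Rightarrow> 'v) \<Rightarrow> nat \<Rightarrow> nat \<Rightarrow>
     'v cochain \<Rightarrow> 'v cochain \<Rightarrow> 'v cochain" where
  "insertion scale \<alpha> m n P Q = (\<lambda>x. \<Sum>\<sigma>\<in>Sh m (n - 1). scale (of_int (sign \<sigma>))
     (Q (\<lambda>j. if j = 0 then P (\<lambda>i. x (\<sigma> i)) else (\<alpha> ^^ (m - 1)) (x (\<sigma> (m + j - 1))))))"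

definition nr_bracket ::
    "('k::field_char_0 \<Rightarrow> 'v::ab_group_add \<Rightarrow> 'v) \<Rightarrow> ('v \<Rightarrow> 'v) \<Rightarrow> nat \<Rightarrow> nat \<Rightarrow>
     'v cochain \<Rightarrow> 'v cochain \<Rightarrow> 'v cochain" where
  "nr_bracket scale \<alpha> m n P Q = insertion scale \<alpha> m n P Q
     - cochain_scale scale ((-1) ^ ((m - 1) * (n - 1))) (insertion scale \<alpha> n m Q P)"

definition c_bracket ::
    "('k::field_char_0 \<Rightarrow> 'v::ab_group_add \<Rightarrow> 'v) \<Rightarrow> ('v \<Rightarrow> 'v \<Rightarrow> 'v) \<Rightarrow> ('v \<Rightarrow> 'v) \<Rightarrow>
     nat \<Rightarrow> nat \<Rightarrow> 'v cochain \<Rightarrow> 'v cochain \<Rightarrow> 'v cochain" where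
  "c_bracket scale bracket \<alpha> m n P Q = (\<lambda>x. \<Sum>\<sigma>\<in>Sh m n. scale (of_int (sign \<sigma>))
     (bracket ((\<alpha> ^^ (n - 1)) (P (\<lambda>i. x (\<sigma> i))))
              ((\<alpha> ^^ (m - 1)) (Q (\<lambda>j. x (\<sigma> (m + j)))))))"

definition bracket_cochain :: "('v \<Rightarrow> 'v \<Rightarrow> 'v) \<Rightarrow> 'v cochain" where
  "bracket_cochain bracket = (\<lambda>x. bracket (x 0) (x 1))"

definition theta ::
    "('k::field_char_0 \<Rightarrow> 'v::ab_group_add \<Rightarrow> 'v) \<Rightarrow> ('v \<Rightarrow> 'v \<Rightarrow> 'v) \<Rightarrow> ('v \<Rightarrow> 'v) \<Rightarrow>
     nat \<Rightarrow> 'v cochain \<Rightarrow> 'v cochain" where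
  "theta scale bracket \<alpha> n f = - insertion scale \<alpha> n 2 f (bracket_cochain bracket)"

definition derived_bracket ::
    "('k::field_char_0 \<Rightarrow> 'v::ab_group_add \<Rightarrow> 'v) \<Rightarrow> ('v \<Rightarrow> 'v \<Rightarrow> 'v) \<Rightarrow> ('v \<Rightarrow> 'v) \<Rightarrow>
     nat \<Rightarrow> nat \<Rightarrow> 'v cochain \<Rightarrow> 'v cochain \<Rightarrow> 'v cochain" where
  "derived_bracket scale bracket \<alpha> m n P Q = c_bracket scale bracket \<alpha> m n P Q
     + insertion scale \<alpha> (m + 1) n (theta scale bracket \<alpha> m P) Q
     - cochain_scale scale ((-1) ^ (m * n))
         (insertion scale \<alpha> (n + 1) m (theta scale bracket \<alpha> n Q) P)"

end

theory Submission
  imports Defs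
begin

text \<open>
  Write \<open>i\<^sub>P Q\<close> for the insertion of a cochain \<open>P\<close> into \<open>Q\<close>.  Everything follows from three identities.

  \<^item> \<open>associator_symmetric\<close>: insertion is a graded pre-Lie product.  In \<open>i\<^sub>P (i\<^sub>Q R)\<close> the cochain \<open>P\<close> lands
    either inside \<open>Q\<close>, and these terms make up \<open>i\<^bsub>i\<^sub>P Q\<^esub> R\<close>, or beside \<open>Q\<close> as another argument of \<open>R\<close>;
    the terms of the second kind are symmetric in \<open>P\<close> and \<open>Q\<close> up to the Koszul sign.  Hence \<open>[ , ]\<^sub>N\<^sub>R\<close>, the
    graded commutator of insertion, is a graded Lie bracket, and \<open>i\<close> represents it by operators.
  \<^item> \<open>plug_cup_derivation\<close>: \<open>i\<^sub>P\<close> is a graded derivation of \<open>[ , ]\<^sub>C\<close>, because \<open>P\<close> lands in one of the two factors.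
  \<^item> \<open>cup_skew\<close> and \<open>cup_jacobi\<close>: \<open>[ , ]\<^sub>C\<close> is a graded Lie bracket.

  Let \<open>e\<close> be the identity map, regarded as a cochain in one argument.  Comparing the two definitions gives
  \<open>\<theta> P = - [P, e]\<^sub>C\<close>, and \<open>i\<^sub>P e = P\<close>.  Thus \<open>\<theta>\<close> is, up to sign, an inner derivation of \<open>[ , ]\<^sub>C\<close>, and the derivation
  rule for \<open>i\<^bsub>\<theta> P\<^esub>\<close> applied to \<open>[Q, e]\<^sub>C\<close> expresses \<open>i\<^bsub>\<theta> P\<^esub> (\<theta> Q)\<close> by \<open>\<theta> (i\<^bsub>\<theta> P\<^esub> Q)\<close> and \<open>[Q, \<theta> P]\<^sub>C\<close>.
  Antisymmetrized, and combined with the Jacobi identity of \<open>[ , ]\<^sub>C\<close> for \<open>P, Q, e\<close>, this says \<open>\<theta> [P, Q]\<^sub>D = [\<theta> P, \<theta> Q]\<^sub>N\<^sub>R\<close> (lemma \<open>theta_db\<close>).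

  Put \<open>L\<^sub>P = i\<^bsub>\<theta> P\<^esub>\<close>.  These operators are derivations of \<open>[ , ]\<^sub>C\<close>, and by what was just said they satisfy
  \<open>[L\<^sub>P, L\<^sub>Q] = L\<^bsub>[P, Q]\<^sub>D\<^esub>\<close>.  So \<open>[P, Q]\<^sub>D = [P, Q]\<^sub>C + L\<^sub>P Q - (-1)\<^sup>m\<^sup>n L\<^sub>Q P\<close> is the bracket that a graded
  post-Lie structure induces, and its Jacobi identity (lemma \<open>db_jacobi\<close>) is a formal consequence.

  The three identities are proved without handling double sums over shuffles.  Call \<open>contract v f\<close> the cochain
  obtained by fixing \<open>v\<close> as first argument of \<open>f\<close>.  A shuffle has its smallest entry at the start of one of
  its two blocks; splitting the sums accordingly shows that contraction is a graded derivation of insertion and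
  of \<open>[ , ]\<^sub>C\<close> (lemmas \<open>plug_scons\<close>, \<open>cup_scons\<close>).  So an identity for \<open>P, Q, R\<close> follows from the same identity for
  contracted cochains, by induction on the total number of arguments.
  A contracted cochain no longer commutes with \<open>\<alpha>\<close>, so the induction needs a more general form: the powers of \<open>\<alpha>\<close>
  are replaced by arbitrary linear maps, and where \<open>Q \<circ> \<beta> = \<beta> \<circ> Q\<close> would be used there are two
  cochains with \<open>Q \<circ> \<beta> = \<beta> \<circ> Q'\<close>.  This relation survives contraction of \<open>Q\<close> with \<open>\<beta> v\<close> and of \<open>Q'\<close> with \<open>v\<close>.
\<close>

section \<open>Sequences and signs\<close>

definition scons :: "'a \<Rightarrow> (nat \<Rightarrow> 'a) \<Rightarrow> nat \<Rightarrow> 'a"  (infixr \<open>##\<close> 65) where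
  "a ## x = (\<lambda>i. case i of 0 \<Rightarrow> a | Suc j \<Rightarrow> x j)"

lemma scons_0 [simp]: "(a ## x) 0 = a"
  and scons_Suc [simp]: "(a ## x) (Suc i) = x i"
  by (simp_all add: scons_def)

lemma scons_eta: "x 0 ## (\<lambda>i. x (Suc i)) = x"
  by (auto simp: scons_def fun_eq_iff split: nat.split)

lemma scons_1 [simp]: "(a ## x) 1 = x 0"
  using scons_Suc[of a x 0] by (simp add: One_nat_def)

lemma scons_eta2: "x 0 ## x 1 ## (\<lambda>i. x (Suc (Suc i))) = x"
  using scons_eta[of x] scons_eta[of "\<lambda>i. x (Suc i)"] by (simp add: One_nat_def)

text \<open>Every sequence has a first entry, so an identity of cochains can be tested with the first argument fixed.\<close>
lemma eq_by_scons: "(\<And>v x. f (v ## x) = g (v ## x)) \<Longrightarrow> f = g"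
  by (metis scons_eta ext)

lemma comp_scons: "(\<lambda>i. f ((a ## x) i)) = f a ## (\<lambda>i. f (x i))"
  by (auto simp: scons_def fun_eq_iff split: nat.split)

lemma scons_upd_0: "(a ## x)(0 := b) = b ## x"
  by (auto simp: scons_def fun_eq_iff split: nat.split)

lemma scons_upd_Suc: "(a ## x)(Suc i := b) = a ## (x(i := b))"
  by (auto simp: scons_def fun_eq_iff split: nat.split)

definition insert_at :: "nat \<Rightarrow> 'a \<Rightarrow> (nat \<Rightarrow> 'a) \<Rightarrow> nat \<Rightarrow> 'a" where
  "insert_at k a x = (\<lambda>i. if i < k then x i else if i = k then a else x (i - 1))"

lemma insert_at_0: "insert_at 0 a x = a ## x"
  by (auto simp: scons_def insert_at_def fun_eq_iff split: nat.split)

lemma insert_at_shift: "(\<lambda>j. insert_at m a x (m + j)) = a ## (\<lambda>j. x (m + j))"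
  by (auto simp: scons_def insert_at_def fun_eq_iff split: nat.split)

text \<open>The scalar \<open>(-1) ^ n\<close>, acting on any abelian group: Koszul signs can then be treated without scalars, and
  an identity between signed terms is settled by distinguishing the parities of the exponents.\<close>
definition signed :: "nat \<Rightarrow> 'a::ab_group_add \<Rightarrow> 'a" where
  "signed n a = (if even n then a else - a)"

lemma signed_0 [simp]: "signed n 0 = 0"
  by (simp add: signed_def)

lemma signed_apply [simp]: "signed n f x = signed n (f x)"
  by (simp add: signed_def)

lemma signed_add: "signed n (a + b) = signed n a + signed n b"
  and signed_diff: "signed n (a - b) = signed n a - signed n b"
  and signed_minus: "signed n (- a) = - signed n a"
  and signed_signed: "signed m (signed n a) = signed (m + n) a"
  by (simp_all add: signed_def)

lemma signed_sum: "signed k (sum f A) = (\<Sum>a\<in>A. signed k (f a))"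
  by (simp add: signed_def sum_negf)

section \<open>Shuffles, split by the position of the smallest entry\<close>

lemma permutes_lessThan_iff:
  "p permutes {..<N::nat} \<longleftrightarrow> inj p \<and> (\<forall>i\<ge>N. p i = i)"
proof
  assume p: "p permutes {..<N}"
  then show "inj p \<and> (\<forall>i\<ge>N. p i = i)"
    by (auto simp: permutes_inj permutes_not_in)
next
  assume p: "inj p \<and> (\<forall>i\<ge>N. p i = i)"
  have "p i < N" if "i < N" for i
    using p that by (metis injD leI leD)
  then have "p ` {..<N} \<subseteq> {..<N}" by auto
  moreover have "inj_on p {..<N}" using p by (auto intro: inj_on_subset)
  ultimately have "bij_betw p {..<N} {..<N}"
    by (simp add: bij_betw_def endo_inj_surj)
  then show "p permutes {..<N}"
    using p by (intro bij_imp_permutes) auto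
qed

text \<open>The permutations with value 0 at position \<open>k\<close> are the \<open>grow k \<tau>\<close>, for permutations \<open>\<tau>\<close> of one letter less.\<close>
definition grow :: "nat \<Rightarrow> (nat \<Rightarrow> nat) \<Rightarrow> nat \<Rightarrow> nat" where
  "grow k \<tau> = insert_at k 0 (\<lambda>i. Suc (\<tau> i))"

definition shrink :: "nat \<Rightarrow> (nat \<Rightarrow> nat) \<Rightarrow> nat \<Rightarrow> nat" where
  "shrink k \<sigma> = (\<lambda>i. \<sigma> (if i < k then i else Suc i) - 1)"

lemma shrink_grow: "shrink k (grow k \<tau>) = \<tau>"
  by (auto simp: shrink_def grow_def insert_at_def fun_eq_iff)

lemma grow_shrink:
  assumes "inj \<sigma>" "\<sigma> k = 0"
  shows "grow k (shrink k \<sigma>) = \<sigma>"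
proof
  fix i
  have "\<sigma> i \<noteq> 0" if "i \<noteq> k" using assms that by (metis injD)
  then show "grow k (shrink k \<sigma>) i = \<sigma> i"
    using assms(2) by (auto simp: shrink_def grow_def insert_at_def)
qed

lemma grow_permutes:
  assumes "\<tau> permutes {..<N}" "k \<le> N"
  shows "grow k \<tau> permutes {..<Suc N}"
proof -
  have t: "\<tau> i = \<tau> j \<longleftrightarrow> i = j" for i j
    using assms(1) by (auto simp: permutes_lessThan_iff dest: injD)
  show ?thesis
    using assms unfolding permutes_lessThan_iff inj_def
    by (auto simp: grow_def insert_at_def t split: if_splits)
qed

lemma shrink_permutes:
  assumes "\<sigma> permutes {..<Suc N}" "\<sigma> k = 0" "k \<le> N"
  shows "shrink k \<sigma> permutes {..<N}"
proof -
  have s: "\<sigma> i = \<sigma> j \<longleftrightarrow> i = j" for i j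
    using assms(1) by (auto simp: permutes_lessThan_iff dest: injD)
  have z: "\<sigma> i \<noteq> 0" if "i \<noteq> k" for i using s[of i k] assms(2) that by auto
  have pred: "\<sigma> i = \<sigma> j" if "\<sigma> i - 1 = \<sigma> j - 1" "i \<noteq> k" "j \<noteq> k" for i j
    using that z[of i] z[of j] by linarith
  have "inj (shrink k \<sigma>)"
  proof (rule injI)
    fix i j assume "shrink k \<sigma> i = shrink k \<sigma> j"
    then have "\<sigma> (if i < k then i else Suc i) = \<sigma> (if j < k then j else Suc j)"
      unfolding shrink_def by (rule pred) auto
    then show "i = j" by (auto simp: s split: if_splits)
  qed
  then show ?thesis
    using assms unfolding permutes_lessThan_iff by (auto simp: shrink_def)
qed

lemma sign_grow_0:
  assumes "\<tau> permutes {..<N}"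
  shows "sign (grow 0 \<tau>) = sign \<tau>"
  using assms finite_lessThan
proof (induction rule: permutes_induct)
  case id
  have "grow 0 id = id"
    by (auto simp: grow_def insert_at_def fun_eq_iff)
  then show ?case by (simp only: sign_id)
next
  case (swap a b p)
  have "grow 0 (Transposition.transpose a b \<circ> p)
      = Transposition.transpose (Suc a) (Suc b) \<circ> grow 0 p"
    by (auto simp: grow_def insert_at_def fun_eq_iff Transposition.transpose_def)
  moreover have "permutation p" "permutation (grow 0 p)"
    using swap grow_permutes[OF swap.hyps(4), of 0]
    by (auto intro: permutes_imp_permutation[OF finite_lessThan])
  ultimately show ?case
    using swap by (simp only: sign_compose permutation_swap_id sign_swap_id) simp
qed

text \<open>Moving the value 0 one position to the right is a composition with an adjacent transposition.\<close>
lemma sign_grow: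
  assumes "\<tau> permutes {..<N}" "k \<le> N"
  shows "sign (grow k \<tau>) = (-1) ^ k * sign \<tau>"
  using assms(2)
proof (induction k)
  case 0
  then show ?case using sign_grow_0[OF assms(1)] by simp
next
  case (Suc k)
  have "grow (Suc k) \<tau> = grow k \<tau> \<circ> Transposition.transpose k (Suc k)"
    by (auto simp: grow_def insert_at_def fun_eq_iff Transposition.transpose_def)
  moreover have "permutation (grow k \<tau>)"
    using grow_permutes[OF assms(1), of k] Suc.prems
    by (auto intro: permutes_imp_permutation[OF finite_lessThan])
  ultimately have "sign (grow (Suc k) \<tau>) = - sign (grow k \<tau>)"
    by (simp only: sign_compose permutation_swap_id sign_swap_id) simp
  then show ?case using Suc by simp
qed

lemma strict_mono_on_nat_iff:
  "strict_mono_on A (f::nat \<Rightarrow> nat) \<longleftrightarrow> (\<forall>i\<in>A. \<forall>j\<in>A. i < j \<longrightarrow> f i < f j)"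
  by (auto simp: strict_mono_on_def)

lemma Sh_iff: "\<sigma> \<in> Sh m n \<longleftrightarrow> \<sigma> permutes {..<m + n} \<and>
    (\<forall>i j. i < j \<longrightarrow> j < m \<longrightarrow> \<sigma> i < \<sigma> j) \<and>
    (\<forall>i j. m \<le> i \<longrightarrow> i < j \<longrightarrow> j < m + n \<longrightarrow> \<sigma> i < \<sigma> j)"
  by (auto simp: Sh_def strict_mono_on_nat_iff)

lemma finite_Sh: "finite (Sh m n)"
  by (rule finite_subset[OF _ finite_permutations[of "{..<m+n}"]]) (auto simp: Sh_iff)

lemma Sh_grow_first: "grow 0 ` Sh m n = {\<sigma> \<in> Sh (Suc m) n. \<sigma> 0 = 0}"
proof (intro equalityI subsetI)
  fix \<sigma> assume "\<sigma> \<in> grow 0 ` Sh m n"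
  then obtain \<tau> where t: "\<sigma> = grow 0 \<tau>" "\<tau> \<in> Sh m n" by auto
  have "\<sigma> permutes {..<Suc m + n}"
    using t grow_permutes[of \<tau> "m + n" 0] by (simp add: Sh_iff)
  moreover have "\<sigma> i < \<sigma> j" if "i < j" "j < Suc m" for i j
    using t that by (auto simp: Sh_iff grow_def insert_at_def)
  moreover have "\<sigma> i < \<sigma> j" if "Suc m \<le> i" "i < j" "j < Suc m + n" for i j
    using t that by (auto simp: Sh_iff grow_def insert_at_def)
  moreover have "\<sigma> 0 = 0" using t by (simp add: grow_def insert_at_def)
  ultimately show "\<sigma> \<in> {\<sigma> \<in> Sh (Suc m) n. \<sigma> 0 = 0}" by (simp add: Sh_iff)
next
  fix \<sigma> assume s: "\<sigma> \<in> {\<sigma> \<in> Sh (Suc m) n. \<sigma> 0 = 0}"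
  then have p: "\<sigma> permutes {..<Suc (m + n)}" and inj: "inj \<sigma>"
    by (auto simp: Sh_iff permutes_inj)
  have pos: "0 < \<sigma> (Suc i)" for i
    using s inj by (metis (mono_tags) injD mem_Collect_eq nat.distinct(1) neq0_conv)
  have lt: "\<sigma> (Suc i) - 1 < \<sigma> (Suc j) - 1" if "\<sigma> (Suc i) < \<sigma> (Suc j)" for i j
    using that pos[of i] by linarith
  have "shrink 0 \<sigma> \<in> Sh m n"
    using s shrink_permutes[OF p, of 0] unfolding Sh_iff
    by (auto simp: shrink_def intro!: lt[simplified])
  then show "\<sigma> \<in> grow 0 ` Sh m n"
    using grow_shrink[OF inj, of 0] s by (intro image_eqI[of _ _ "shrink 0 \<sigma>"]) auto
qed

lemma Sh_grow_second: "grow m ` Sh m n = {\<sigma> \<in> Sh m (Suc n). \<sigma> m = 0}"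
proof (intro equalityI subsetI)
  fix \<sigma> assume "\<sigma> \<in> grow m ` Sh m n"
  then obtain \<tau> where t: "\<sigma> = grow m \<tau>" "\<tau> \<in> Sh m n" by auto
  have "\<sigma> permutes {..<m + Suc n}"
    using t grow_permutes[of \<tau> "m + n" m] by (simp add: Sh_iff)
  moreover have "\<sigma> i < \<sigma> j" if "i < j" "j < m" for i j
    using t that by (auto simp: Sh_iff grow_def insert_at_def)
  moreover have "\<sigma> i < \<sigma> j" if "m \<le> i" "i < j" "j < m + Suc n" for i j
  proof -
    have "\<tau> (i - 1) < \<tau> (j - 1)" if "m < i"
    proof -
      have "m \<le> i - 1" "i - 1 < j - 1" "j - 1 < m + n"
        using that \<open>i < j\<close> \<open>j < m + Suc n\<close> by linarith+
      then show ?thesis using t(2) unfolding Sh_iff by blast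
    qed
    then show ?thesis using t that by (auto simp: grow_def insert_at_def)
  qed
  moreover have "\<sigma> m = 0" using t by (simp add: grow_def insert_at_def)
  ultimately show "\<sigma> \<in> {\<sigma> \<in> Sh m (Suc n). \<sigma> m = 0}" by (simp add: Sh_iff)
next
  fix \<sigma> assume s: "\<sigma> \<in> {\<sigma> \<in> Sh m (Suc n). \<sigma> m = 0}"
  then have p: "\<sigma> permutes {..<Suc (m + n)}" and inj: "inj \<sigma>"
    by (auto simp: Sh_iff permutes_inj)
  have lt: "\<sigma> i - 1 < \<sigma> j - 1" if "\<sigma> i < \<sigma> j" "i \<noteq> m" for i j
  proof -
    have "\<sigma> i \<noteq> 0" using s inj that by (metis (mono_tags) injD mem_Collect_eq)
    then show ?thesis using that by linarith
  qed
  have "shrink m \<sigma> \<in> Sh m n"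
    using s shrink_permutes[OF p, of m] unfolding Sh_iff
    by (auto simp: shrink_def intro!: lt[simplified])
  then show "\<sigma> \<in> grow m ` Sh m n"
    using grow_shrink[OF inj, of m] s by (intro image_eqI[of _ _ "shrink m \<sigma>"]) auto
qed

text \<open>Each of the two blocks is increasing, so the value 0 can only stand at the start of a block.\<close>
lemma Sh_zero_position:
  assumes "\<sigma> \<in> Sh m n" "0 < m + n"
  shows "0 < m \<and> \<sigma> 0 = 0 \<or> 0 < n \<and> \<sigma> m = 0"
proof -
  have p: "\<sigma> permutes {..<m + n}" using assms by (simp add: Sh_iff)
  obtain i where i: "\<sigma> i = 0" using permutes_surj[OF p] by (metis surjD)
  have "i < m + n"
  proof (rule ccontr)
    assume "\<not> i < m + n"
    then have "\<sigma> i = i" using p by (simp add: permutes_lessThan_iff)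
    then show False using i assms(2) \<open>\<not> i < m + n\<close> by simp
  qed
  show ?thesis
  proof (cases "i < m")
    case True
    have "i = 0"
    proof (rule ccontr)
      assume "i \<noteq> 0"
      then have "\<sigma> 0 < \<sigma> i" using assms(1) True by (simp add: Sh_iff)
      then show False using i by simp
    qed
    then show ?thesis using i True by simp
  next
    case False
    have "i = m"
    proof (rule ccontr)
      assume "i \<noteq> m"
      then have "\<sigma> m < \<sigma> i" using assms(1) False \<open>i < m + n\<close> by (simp add: Sh_iff)
      then show False using i by simp
    qed
    then show ?thesis using i \<open>i < m + n\<close> by simp
  qed
qed

lemma Sh_0_0: "Sh 0 0 = {id}"
  by (auto simp: Sh_iff)

section \<open>Signed sums over shuffles\<close>

locale cochain_space = vector_space scale
  for scale :: "'k::field \<Rightarrow> 'v::ab_group_add \<Rightarrow> 'v" (infixr \<open>*s\<close> 75)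
begin

definition shuffle_sum :: "nat \<Rightarrow> nat \<Rightarrow> ((nat \<Rightarrow> 'v) \<Rightarrow> 'v) \<Rightarrow> (nat \<Rightarrow> 'v) \<Rightarrow> 'v" where
  "shuffle_sum m n \<Phi> x = (\<Sum>\<sigma>\<in>Sh m n. scale (of_int (sign \<sigma>)) (\<Phi> (\<lambda>i. x (\<sigma> i))))"

lemma shuffle_sum_0_0: "shuffle_sum 0 0 \<Phi> x = \<Phi> x"
  by (simp add: shuffle_sum_def Sh_0_0)

lemma comp_grow: "(\<lambda>i. (v ## x) (grow k \<tau> i)) = insert_at k v (\<lambda>i. x (\<tau> i))"
  by (auto simp: grow_def insert_at_def fun_eq_iff)

lemma scale_sign_grow:
  assumes "\<tau> permutes {..<N}" "k \<le> N"
  shows "scale (of_int (sign (grow k \<tau>))) a = signed k (scale (of_int (sign \<tau>)) a)"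
  by (simp add: sign_grow[OF assms] signed_def)

lemma inj_grow: "inj (grow k)"
  by (metis injI shrink_grow)

lemma shuffle_sum_first:
  "(\<Sum>\<sigma>\<in>{\<sigma> \<in> Sh (Suc m) n. \<sigma> 0 = 0}. scale (of_int (sign \<sigma>)) (\<Phi> (\<lambda>i. (v ## x) (\<sigma> i))))
     = shuffle_sum m n (\<lambda>y. \<Phi> (v ## y)) x"
proof -
  have "scale (of_int (sign (grow 0 \<tau>))) (\<Phi> (\<lambda>i. (v ## x) (grow 0 \<tau> i)))
      = scale (of_int (sign \<tau>)) (\<Phi> (v ## (\<lambda>i. x (\<tau> i))))" if "\<tau> \<in> Sh m n" for \<tau>
    using that by (simp add: comp_grow insert_at_0 scale_sign_grow[of \<tau> "m + n"] Sh_iff signed_def)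
  then show ?thesis
    unfolding Sh_grow_first[symmetric] shuffle_sum_def
    by (subst sum.reindex) (auto simp: inj_grow inj_on_subset[OF inj_grow] intro!: sum.cong)
qed

lemma shuffle_sum_second:
  "(\<Sum>\<sigma>\<in>{\<sigma> \<in> Sh m (Suc n). \<sigma> m = 0}. scale (of_int (sign \<sigma>)) (\<Phi> (\<lambda>i. (v ## x) (\<sigma> i))))
     = signed m (shuffle_sum m n (\<lambda>y. \<Phi> (insert_at m v y)) x)"
proof -
  have "scale (of_int (sign (grow m \<tau>))) (\<Phi> (\<lambda>i. (v ## x) (grow m \<tau> i)))
      = signed m (scale (of_int (sign \<tau>)) (\<Phi> (insert_at m v (\<lambda>i. x (\<tau> i)))))" if "\<tau> \<in> Sh m n" for \<tau>
    using that by (simp add: comp_grow scale_sign_grow[of \<tau> "m + n"] Sh_iff)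
  then show ?thesis
    unfolding Sh_grow_second[symmetric] shuffle_sum_def signed_sum
    by (subst sum.reindex) (auto simp: inj_grow inj_on_subset[OF inj_grow] intro!: sum.cong)
qed

text \<open>The recursion behind all later inductions.  The vector \<open>v\<close> has the smallest index; it goes to the start of
  the first block, or to the start of the second block after passing the \<open>m\<close> entries of the first one.\<close>
lemma shuffle_sum_scons:
  assumes "0 < m + n"
  shows "shuffle_sum m n \<Phi> (v ## x) =
      (if m = 0 then 0 else shuffle_sum (m - 1) n (\<lambda>y. \<Phi> (v ## y)) x) +
      (if n = 0 then 0 else signed m (shuffle_sum m (n - 1) (\<lambda>y. \<Phi> (insert_at m v y)) x))"
proof -
  let ?A = "if m = 0 then {} else {\<sigma> \<in> Sh m n. \<sigma> 0 = 0}"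
  let ?B = "if n = 0 then {} else {\<sigma> \<in> Sh m n. \<sigma> m = 0}"
  let ?f = "\<lambda>\<sigma>. scale (of_int (sign \<sigma>)) (\<Phi> (\<lambda>i. (v ## x) (\<sigma> i)))"
  have "\<forall>\<sigma>\<in>Sh m n. m \<noteq> 0 \<longrightarrow> \<sigma> 0 = 0 \<longrightarrow> \<sigma> m \<noteq> 0"
    by (metis Sh_iff permutes_inj injD)
  then have disj: "?A \<inter> ?B = {}" by auto
  have "\<forall>\<sigma>\<in>Sh m n. 0 < m \<and> \<sigma> 0 = 0 \<or> 0 < n \<and> \<sigma> m = 0"
    using Sh_zero_position[OF _ assms] by blast
  then have "Sh m n = ?A \<union> ?B" by (intro equalityI subsetI) (auto split: if_splits)
  then have "sum ?f (Sh m n) = sum ?f (?A \<union> ?B)" by (rule arg_cong[where f = "sum ?f"])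
  also have "\<dots> = sum ?f ?A + sum ?f ?B"
    by (rule sum.union_disjoint[OF _ _ disj]) (simp_all add: finite_Sh)
  also have "sum ?f ?A = (if m = 0 then 0 else shuffle_sum (m - 1) n (\<lambda>y. \<Phi> (v ## y)) x)"
    by (cases m) (simp_all add: shuffle_sum_first)
  also have "sum ?f ?B = (if n = 0 then 0
      else signed m (shuffle_sum m (n - 1) (\<lambda>y. \<Phi> (insert_at m v y)) x))"
    by (cases n) (simp_all add: shuffle_sum_second)
  finally show ?thesis by (simp only: shuffle_sum_def[of m n \<Phi>])
qed

lemma shuffle_sum_zero: "shuffle_sum m n (\<lambda>y. 0) x = 0"
  by (simp add: shuffle_sum_def)

lemma shuffle_sum_add:
  "shuffle_sum m n (\<lambda>y. \<Phi> y + \<Psi> y) x = shuffle_sum m n \<Phi> x + shuffle_sum m n \<Psi> x"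
  by (simp add: shuffle_sum_def scale_right_distrib sum.distrib)

lemma shuffle_sum_scale:
  "shuffle_sum m n (\<lambda>y. scale c (\<Phi> y)) x = scale c (shuffle_sum m n \<Phi> x)"
  by (simp add: shuffle_sum_def scale_sum_right mult.commute)

lemma shuffle_sum_minus: "shuffle_sum m n (\<lambda>y. - \<Phi> y) x = - shuffle_sum m n \<Phi> x"
  using shuffle_sum_scale[of m n "-1" \<Phi> x] by simp

lemma shuffle_sum_n_0: "shuffle_sum m 0 \<Phi> x = \<Phi> x"
proof (induction m arbitrary: \<Phi> x)
  case 0
  then show ?case by (simp add: shuffle_sum_0_0)
next
  case (Suc m)
  have "shuffle_sum (Suc m) 0 \<Phi> (x 0 ## (\<lambda>i. x (Suc i))) = \<Phi> (x 0 ## (\<lambda>i. x (Suc i)))"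
    by (subst shuffle_sum_scons) (simp_all add: Suc)
  then show ?case by (simp add: scons_eta)
qed

lemma shuffle_sum_m_0: "shuffle_sum 0 n \<Phi> x = \<Phi> x"
proof (induction n arbitrary: \<Phi> x)
  case 0
  then show ?case by (simp add: shuffle_sum_0_0)
next
  case (Suc n)
  have "shuffle_sum 0 (Suc n) \<Phi> (x 0 ## (\<lambda>i. x (Suc i))) = \<Phi> (x 0 ## (\<lambda>i. x (Suc i)))"
    by (subst shuffle_sum_scons) (simp_all add: Suc insert_at_0 signed_def)
  then show ?case by (simp add: scons_eta)
qed

end

section \<open>Alternating multilinear cochains\<close>

text \<open>Arities such as \<open>m - 1\<close> occur in terms and in the facts that rewrite them; they should keep this form.\<close>
declare One_nat_def [simp del]

context cochain_space
begin

abbreviation lin :: "('v \<Rightarrow> 'v) \<Rightarrow> bool" where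
  "lin \<equiv> Vector_Spaces.linear scale scale"

lemma lin_iff: "lin f \<longleftrightarrow> (\<forall>u v. f (u + v) = f u + f v) \<and> (\<forall>c v. f (c *s v) = c *s f v)"
  by (simp add: Vector_Spaces.linear_iff vector_space_axioms)

lemma lin_add: "lin f \<Longrightarrow> f (u + v) = f u + f v"
  and lin_scale: "lin f \<Longrightarrow> f (c *s v) = c *s f v"
  by (simp_all add: lin_iff)

lemma lin_zero: "lin f \<Longrightarrow> f 0 = 0"
  using lin_scale[of f 0 0] by simp

lemma lin_minus: "lin f \<Longrightarrow> f (- v) = - f v"
  using lin_scale[of f "-1" v] by simp

definition alternating :: "nat \<Rightarrow> 'v cochain set" where
  "alternating n = {f.
     (\<forall>x y. (\<forall>i<n. x i = y i) \<longrightarrow> f x = f y) \<and>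
     (\<forall>x. \<forall>i<n. lin (\<lambda>v. f (x(i := v)))) \<and>
     (\<forall>x. \<forall>i<n. \<forall>j<n. i \<noteq> j \<longrightarrow> x i = x j \<longrightarrow> f x = 0)}"

lemma alternatingI:
  assumes "\<And>x y. (\<And>i. i < n \<Longrightarrow> x i = y i) \<Longrightarrow> f x = f y"
    and "\<And>x i. i < n \<Longrightarrow> lin (\<lambda>v. f (x(i := v)))"
    and "\<And>x i j. i < n \<Longrightarrow> j < n \<Longrightarrow> i \<noteq> j \<Longrightarrow> x i = x j \<Longrightarrow> f x = 0"
  shows "f \<in> alternating n"
  unfolding alternating_def using assms by blast

lemma alternating_local: "f \<in> alternating n \<Longrightarrow> (\<And>i. i < n \<Longrightarrow> x i = y i) \<Longrightarrow> f x = f y"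
  by (auto simp: alternating_def)

lemma alternating_eq_0:
  "f \<in> alternating n \<Longrightarrow> i < n \<Longrightarrow> j < n \<Longrightarrow> i \<noteq> j \<Longrightarrow> x i = x j \<Longrightarrow> f x = 0"
  by (auto simp: alternating_def)

lemma alternating_lin: "f \<in> alternating n \<Longrightarrow> i < n \<Longrightarrow> lin (\<lambda>v. f (x(i := v)))"
  by (auto simp: alternating_def)

lemma alternating_head: "f \<in> alternating n \<Longrightarrow> 0 < n \<Longrightarrow> lin (\<lambda>v. f (v ## x))"
  using alternating_lin[of f n 0 "0 ## x"] by (simp add: scons_upd_0)

lemma alternating_head_add: "f \<in> alternating n \<Longrightarrow> 0 < n \<Longrightarrow> f ((u + v) ## x) = f (u ## x) + f (v ## x)"
  and alternating_head_scale: "f \<in> alternating n \<Longrightarrow> 0 < n \<Longrightarrow> f ((c *s v) ## x) = c *s f (v ## x)"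
  and alternating_head_zero: "f \<in> alternating n \<Longrightarrow> 0 < n \<Longrightarrow> f (0 ## x) = 0"
  using alternating_head[of f n x] lin_add lin_scale lin_zero by blast+

lemma alternating_repeat: "f \<in> alternating n \<Longrightarrow> 2 \<le> n \<Longrightarrow> f (v ## v ## x) = 0"
  by (rule alternating_eq_0[of f n 0 1]) simp_all

lemma tail_alternating: "f \<in> alternating (Suc n) \<Longrightarrow> (\<lambda>x. f (v ## x)) \<in> alternating n"
  unfolding alternating_def mem_Collect_eq
proof (intro conjI allI impI; elim conjE)
  fix x y :: "nat \<Rightarrow> 'v"
  assume "\<forall>x y. (\<forall>i<Suc n. x i = y i) \<longrightarrow> f x = f y" "\<forall>i<n. x i = y i"
  moreover from this(2) have "\<forall>i<Suc n. (v ## x) i = (v ## y) i"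
    by (auto simp: less_Suc_eq_0_disj)
  ultimately show "f (v ## x) = f (v ## y)" by blast
next
  fix x i assume "\<forall>x. \<forall>i<Suc n. lin (\<lambda>u. f (x(i := u)))" "i < n"
  then have "lin (\<lambda>u. f ((v ## x)(Suc i := u)))" by blast
  then show "lin (\<lambda>u. f (v ## x(i := u)))" by (simp add: scons_upd_Suc)
next
  fix x :: "nat \<Rightarrow> 'v" and i j
  assume "\<forall>x. \<forall>i<Suc n. \<forall>j<Suc n. i \<noteq> j \<longrightarrow> x i = x j \<longrightarrow> f x = 0"
    "i < n" "j < n" "i \<noteq> j" "x i = x j"
  then show "f (v ## x) = 0"
    by (metis Suc_less_eq nat.inject scons_Suc)
qed

text \<open>Polarization in the first two arguments.\<close>
lemma swap_from_repeat:
  assumes "\<And>u v x. f ((u + v) ## x) = f (u ## x) + f (v ## x)"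
    and "\<And>w u v x. f (w ## (u + v) ## x) = f (w ## u ## x) + f (w ## v ## x)"
    and "\<And>v x. f (v ## v ## x) = (0::'v)"
  shows "f (u ## v ## x) = - f (v ## u ## x)"
proof -
  have "f ((u + v) ## (u + v) ## x) = f (u ## v ## x) + f (v ## u ## x)"
    unfolding assms(1,2) by (simp add: assms(3))
  then show ?thesis by (simp add: assms(3) eq_neg_iff_add_eq_0)
qed

lemma alternating_swap:
  assumes "f \<in> alternating n" "2 \<le> n"
  shows "f (u ## v ## x) = - f (v ## u ## x)"
proof (rule swap_from_repeat)
  fix w u v x
  have "(\<lambda>x. f (w ## x)) \<in> alternating (n - 1)"
    using assms tail_alternating[of f "n - 1"] by simp
  from alternating_head_add[OF this] assms(2)
  show "f (w ## (u + v) ## x) = f (w ## u ## x) + f (w ## v ## x)" by auto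
qed (use assms in \<open>auto simp: alternating_head_add alternating_repeat\<close>)

text \<open>Alternation need only be tested on the contracted maps and on a repetition in the first two places: if entry 0 is
  repeated at a later place, exchanging the first two arguments moves the repetition into a contracted map.\<close>
lemma alternating_SucI:
  assumes tail: "\<And>v. (\<lambda>x. f (v ## x)) \<in> alternating n"
    and head: "\<And>x. lin (\<lambda>v. f (v ## x))"
    and repeat: "\<And>v x. 0 < n \<Longrightarrow> f (v ## v ## x) = 0"
  shows "f \<in> alternating (Suc n)"
proof -
  have loc: "f x = f y" if xy: "\<And>i. i < Suc n \<Longrightarrow> x i = y i" for x y
  proof -
    have "f (x 0 ## (\<lambda>i. x (Suc i))) = f (x 0 ## (\<lambda>i. y (Suc i)))"
      by (rule alternating_local[OF tail[of "x 0"]]) (simp add: xy)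
    moreover have "x 0 = y 0" by (rule xy) simp
    ultimately show ?thesis using scons_eta[of x] scons_eta[of y] by simp
  qed
  have lin: "lin (\<lambda>v. f (x(i := v)))" if "i < Suc n" for x i
  proof (cases i)
    case 0
    then show ?thesis using head[of "\<lambda>i. x (Suc i)"] scons_upd_0[of "x 0" "\<lambda>i. x (Suc i)"]
      by (simp add: scons_eta)
  next
    case (Suc j)
    then show ?thesis
      using alternating_lin[OF tail[of "x 0"], where i = j and x = "\<lambda>i. x (Suc i)"] that
        scons_upd_Suc[of "x 0" "\<lambda>i. x (Suc i)" j] by (simp add: scons_eta)
  qed
  have zero_head: "f x = 0" if "0 < j" "j < Suc n" "x 0 = x j" for x j
  proof (cases "j = 1")
    case True
    define z where "z = (\<lambda>i. x (Suc (Suc i)))"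
    have "x = x 0 ## x 1 ## z"
      by (simp add: z_def scons_eta2)
    then have "f x = f (x 0 ## x 0 ## z)" using that True by metis
    then show ?thesis using repeat that by simp
  next
    case False
    define z where "z = (\<lambda>i. x (Suc (Suc i)))"
    have x: "x = x 0 ## x 1 ## z"
      by (simp add: z_def scons_eta2)
    have "f (x 0 ## x 1 ## z) = - f (x 1 ## x 0 ## z)"
    proof (rule swap_from_repeat)
      show "f ((u + v) ## x) = f (u ## x) + f (v ## x)" for u v x
        using lin_add[OF head] .
      show "f (w ## (u + v) ## x) = f (w ## u ## x) + f (w ## v ## x)" for w u v x
        using alternating_head_add[OF tail] that by auto
      show "f (v ## v ## x) = 0" for v x using repeat that by simp
    qed
    moreover have "f (x 1 ## x 0 ## z) = 0"
    proof (rule alternating_eq_0[OF tail])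
      show "0 < n" "j - 1 < n" "0 \<noteq> j - 1" using that False by auto
      have "j = Suc (Suc (j - 2))" "j - 1 = Suc (j - 2)" using that False by auto
      then show "(x 0 ## z) 0 = (x 0 ## z) (j - 1)"
        using that(3) by (metis scons_0 scons_Suc z_def)
    qed
    ultimately show ?thesis using x by simp
  qed
  have zero: "f x = 0" if "i < Suc n" "j < Suc n" "i \<noteq> j" "x i = x j" for x i j
  proof (cases "i = 0 \<or> j = 0")
    case True
    then show ?thesis using zero_head[of i x] zero_head[of j x] that by auto
  next
    case False
    have "f (x 0 ## (\<lambda>i. x (Suc i))) = 0"
      by (rule alternating_eq_0[OF tail, of "i - 1" "j - 1"]) (use that False in auto)
    then show ?thesis by (simp add: scons_eta)
  qed
  show ?thesis by (rule alternatingI[OF loc lin zero])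
qed

lemma zero_alternating: "0 \<in> alternating n"
  by (auto simp: alternating_def lin_iff)

lemma add_alternating:
  assumes f: "f \<in> alternating n" and g: "g \<in> alternating n"
  shows "f + g \<in> alternating n"
proof (rule alternatingI)
  show "(f + g) x = (f + g) y" if "\<And>i. i < n \<Longrightarrow> x i = y i" for x y
    using alternating_local[OF f that] alternating_local[OF g that] by simp
  show "lin (\<lambda>v. (f + g) (x(i := v)))" if "i < n" for x i
    using alternating_lin[OF f that, of x] alternating_lin[OF g that, of x]
    by (simp add: lin_iff scale_right_distrib add_ac)
  show "(f + g) x = 0" if "i < n" "j < n" "i \<noteq> j" "x i = x j" for x i j
    using alternating_eq_0[OF f that] alternating_eq_0[OF g that] by simp
qed

lemma scale_alternating:
  assumes f: "f \<in> alternating n"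
  shows "(\<lambda>x. c *s f x) \<in> alternating n"
proof (rule alternatingI)
  show "c *s f x = c *s f y" if "\<And>i. i < n \<Longrightarrow> x i = y i" for x y
    using alternating_local[OF f that] by simp
  show "lin (\<lambda>v. c *s f (x(i := v)))" if "i < n" for x i
    using alternating_lin[OF f that, of x]
    by (simp add: lin_iff scale_right_distrib mult.commute)
  show "c *s f x = 0" if "i < n" "j < n" "i \<noteq> j" "x i = x j" for x i j
    using alternating_eq_0[OF f that] by simp
qed

lemma minus_alternating: "f \<in> alternating n \<Longrightarrow> - f \<in> alternating n"
  using scale_alternating[of f n "-1"] by (simp add: fun_Compl_def)

lemma signed_alternating: "f \<in> alternating n \<Longrightarrow> signed k f \<in> alternating n"
  by (simp add: signed_def minus_alternating)

text \<open>The contraction of a cochain without arguments is 0.  With this convention the Leibniz rules for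
  contraction hold for all arities: a term in which nothing can be contracted vanishes.\<close>
definition contract :: "nat \<Rightarrow> 'v \<Rightarrow> 'v cochain \<Rightarrow> 'v cochain" where
  "contract n v f = (if n = 0 then 0 else (\<lambda>x. f (v ## x)))"

lemma contract_0: "contract 0 v f = 0"
  by (simp add: contract_def)

lemma contract_alternating: "f \<in> alternating n \<Longrightarrow> contract n v f \<in> alternating (n - 1)"
  by (cases n) (auto simp: contract_def zero_alternating tail_alternating)

lemma contract_contract: "f \<in> alternating n \<Longrightarrow> contract (n - 1) v (contract n v f) = 0"
  using alternating_repeat[of f n] by (auto simp: contract_def fun_eq_iff)

lemma contract_lin_add: "f \<in> alternating n \<Longrightarrow> contract n (u + v) f = contract n u f + contract n v f"
  by (auto simp: contract_def alternating_head_add fun_eq_iff)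

lemma contract_lin_scale: "f \<in> alternating n \<Longrightarrow> contract n (c *s v) f = (\<lambda>x. c *s contract n v f x)"
  by (auto simp: contract_def alternating_head_scale fun_eq_iff)

end

section \<open>Insertion of one cochain into another\<close>

context cochain_space
begin

text \<open>The insertion \<open>i\<^sub>P Q\<close> with an arbitrary map \<open>\<beta>\<close> applied to the arguments that bypass \<open>P\<close>.  The value 0 for
  \<open>n = 0\<close> keeps the Leibniz rule \<open>plug_scons\<close> valid for \<open>n = 1\<close>, when there is no argument that bypasses \<open>P\<close>.\<close>
definition plug :: "('v \<Rightarrow> 'v) \<Rightarrow> nat \<Rightarrow> nat \<Rightarrow> 'v cochain \<Rightarrow> 'v cochain \<Rightarrow> 'v cochain" where
  "plug \<beta> m n P Q = (if n = 0 then 0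
     else shuffle_sum m (n - 1) (\<lambda>y. Q (P y ## (\<lambda>j. \<beta> (y (m + j))))))"

lemma plug_n_0 [simp]: "plug \<beta> m 0 P Q = 0"
  by (simp add: plug_def)

lemma plug_zero_left: "Q \<in> alternating n \<Longrightarrow> plug \<beta> m n 0 Q = 0"
  by (auto simp: plug_def alternating_head_zero shuffle_sum_zero fun_eq_iff)

lemma plug_zero_right: "plug \<beta> m n P 0 = 0"
  by (auto simp: plug_def shuffle_sum_zero fun_eq_iff)

lemma plug_add_left: "Q \<in> alternating n \<Longrightarrow> plug \<beta> m n (P + P') Q = plug \<beta> m n P Q + plug \<beta> m n P' Q"
  by (auto simp: plug_def alternating_head_add shuffle_sum_add fun_eq_iff)

lemma plug_add_right: "plug \<beta> m n P (Q + Q') = plug \<beta> m n P Q + plug \<beta> m n P Q'"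
  by (auto simp: plug_def shuffle_sum_add fun_eq_iff)

lemma plug_scale_left:
  "Q \<in> alternating n \<Longrightarrow> plug \<beta> m n (\<lambda>x. c *s P x) Q = (\<lambda>x. c *s plug \<beta> m n P Q x)"
  by (auto simp: plug_def alternating_head_scale shuffle_sum_scale fun_eq_iff)

lemma plug_scale_right: "plug \<beta> m n P (\<lambda>x. c *s Q x) = (\<lambda>x. c *s plug \<beta> m n P Q x)"
  by (auto simp: plug_def shuffle_sum_scale fun_eq_iff)

lemma plug_minus_left: "Q \<in> alternating n \<Longrightarrow> plug \<beta> m n (- P) Q = - plug \<beta> m n P Q"
  using plug_scale_left[of Q n \<beta> m "-1" P] by (simp add: fun_Compl_def)

lemma plug_minus_right: "plug \<beta> m n P (- Q) = - plug \<beta> m n P Q"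
  using plug_scale_right[of \<beta> m n P "-1" Q] by (simp add: fun_Compl_def)

lemma plug_signed_left: "Q \<in> alternating n \<Longrightarrow> plug \<beta> m n (signed k P) Q = signed k (plug \<beta> m n P Q)"
  by (simp add: signed_def plug_minus_left)

lemma plug_signed_right: "plug \<beta> m n P (signed k Q) = signed k (plug \<beta> m n P Q)"
  by (simp add: signed_def plug_minus_right)

text \<open>Contraction is a graded derivation of insertion: \<open>v\<close> is the first argument of \<open>P\<close>, or it bypasses \<open>P\<close> and enters
  \<open>Q\<close> as \<open>\<beta> v\<close>, behind the value of \<open>P\<close>.  Moving it to the front of \<open>Q\<close> costs the sign in \<open>m + 1\<close> instead of \<open>m\<close>.\<close>
lemma plug_scons:
  assumes P: "P \<in> alternating m" and Q: "Q \<in> alternating n" and "2 \<le> m + n"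
  shows "plug \<beta> m n P Q (v ## x) = plug \<beta> (m - 1) n (contract m v P) Q x
    + signed (m + 1) (plug \<beta> m (n - 1) P (contract n (\<beta> v) Q) x)"
proof (cases n)
  case 0
  then show ?thesis by simp
next
  case (Suc k)
  define \<Phi> where "\<Phi> = (\<lambda>y. Q (P y ## (\<lambda>j. \<beta> (y (m + j)))))"
  have "plug \<beta> m n P Q (v ## x) = shuffle_sum m k \<Phi> (v ## x)"
    by (simp add: plug_def Suc \<Phi>_def)
  also have "\<dots> = (if m = 0 then 0 else shuffle_sum (m - 1) k (\<lambda>y. \<Phi> (v ## y)) x) +
      (if k = 0 then 0 else signed m (shuffle_sum m (k - 1) (\<lambda>y. \<Phi> (insert_at m v y)) x))"
    by (rule shuffle_sum_scons) (use assms(3) Suc in linarith)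
  also have "(if m = 0 then 0 else shuffle_sum (m - 1) k (\<lambda>y. \<Phi> (v ## y)) x)
      = plug \<beta> (m - 1) n (contract m v P) Q x"
  proof (cases m)
    case 0
    then show ?thesis using plug_zero_left[OF Q] by (simp add: contract_0)
  next
    case (Suc l)
    then show ?thesis by (simp add: plug_def \<open>n = Suc k\<close> \<Phi>_def contract_def)
  qed
  also have "(if k = 0 then 0 else signed m (shuffle_sum m (k - 1) (\<lambda>y. \<Phi> (insert_at m v y)) x))
      = signed (m + 1) (plug \<beta> m (n - 1) P (contract n (\<beta> v) Q) x)"
  proof (cases "k = 0")
    case True
    then show ?thesis using Suc by simp
  next
    case False
    have "\<Phi> (insert_at m v y) = - contract n (\<beta> v) Q (P y ## (\<lambda>j. \<beta> (y (m + j))))" for y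
    proof -
      have "P (insert_at m v y) = P y"
        by (rule alternating_local[OF P]) (simp add: insert_at_def)
      moreover have "(\<lambda>j. \<beta> (insert_at m v y (m + j))) = \<beta> v ## (\<lambda>j. \<beta> (y (m + j)))"
        using comp_scons[of \<beta> v "\<lambda>j. y (m + j)"] by (simp add: insert_at_shift[symmetric])
      ultimately show ?thesis
        using alternating_swap[OF Q, of "P y" "\<beta> v"] False Suc by (simp add: \<Phi>_def contract_def)
    qed
    then show ?thesis
      using False Suc by (simp add: plug_def shuffle_sum_minus signed_def)
  qed
  finally show ?thesis .
qed

lemma contract_plug:
  assumes P: "P \<in> alternating m" and Q: "Q \<in> alternating n"
  shows "contract (m + n - 1) v (plug \<beta> m n P Q) = plug \<beta> (m - 1) n (contract m v P) Q
    + signed (m + 1) (plug \<beta> m (n - 1) P (contract n (\<beta> v) Q))"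
proof (cases "2 \<le> m + n")
  case True
  then have "m + n - 1 \<noteq> 0" by linarith
  then show ?thesis
    unfolding contract_def[of "m + n - 1"] by (simp add: plug_scons[OF assms True] fun_eq_iff)
next
  case False
  then consider "n = 0" | "m = 0" "n = 1" by linarith
  then show ?thesis
    using plug_zero_left[OF Q] by cases (simp_all add: contract_def fun_eq_iff)
qed

text \<open>By induction on the arity.  Contracting twice with the same \<open>v\<close> leaves two mixed terms, which cancel because
  their signs belong to \<open>m\<close> and \<open>m + 1\<close>.\<close>
lemma plug_alternating:
  assumes "P \<in> alternating m" "Q \<in> alternating n" "lin \<beta>"
  shows "plug \<beta> m n P Q \<in> alternating (m + n - 1)"
  using assms(1,2)
proof (induction "m + n - 1" arbitrary: m n P Q)
  case 0
  then consider "n = 0" | "m = 0" "n = 1" by linarith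
  then show ?case
  proof cases
    case 2
    then have "P x = P y" "Q (P x ## z) = Q (P x ## w)" for x y z w
      using alternating_local[OF 0(2)] alternating_local[OF 0(3), of "P x ## z" "P x ## w"] by auto
    then have "Q (P x ## z) = Q (P y ## w)" for x y z w by metis
    then show ?thesis using 2 by (simp add: plug_def shuffle_sum_0_0 alternating_def)
  next
    case 1
    then have "plug \<beta> m n P Q = 0" by (simp only: plug_n_0)
    then show ?thesis by (simp only: zero_alternating)
  qed
next
  case (Suc N)
  note P = Suc(3) and Q = Suc(4)
  have ge: "2 \<le> m + n" using Suc(2) by simp
  note rec = plug_scons[OF P Q ge, of \<beta>]
  have cP: "contract m v P \<in> alternating (m - 1)" for v by (rule contract_alternating[OF P])
  have cQ: "contract n v Q \<in> alternating (n - 1)" for v by (rule contract_alternating[OF Q])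
  have left: "plug \<beta> (m - 1) n (contract m v P) Q \<in> alternating N" for v
  proof (cases "m = 0")
    case True
    then show ?thesis by (simp add: contract_0 plug_zero_left[OF Q] zero_alternating)
  next
    case False
    then have N: "N = (m - 1) + n - 1" using Suc(2) by linarith
    show ?thesis using Suc(1)[OF N cP Q] N by simp
  qed
  have right: "plug \<beta> m (n - 1) P (contract n v Q) \<in> alternating N" for v
  proof (cases "n = 0")
    case True
    then show ?thesis by (simp add: zero_alternating)
  next
    case False
    then have N: "N = m + (n - 1) - 1" using Suc(2) by linarith
    show ?thesis using Suc(1)[OF N P cQ] N by simp
  qed
  have "plug \<beta> m n P Q \<in> alternating (Suc N)"
  proof (rule alternating_SucI)
    fix v
    have "(\<lambda>x. plug \<beta> m n P Q (v ## x)) = plug \<beta> (m - 1) n (contract m v P) Q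
        + signed (m + 1) (plug \<beta> m (n - 1) P (contract n (\<beta> v) Q))"
      by (auto simp: rec)
    then show "(\<lambda>x. plug \<beta> m n P Q (v ## x)) \<in> alternating N"
      using left right by (simp add: add_alternating signed_alternating)
  next
    fix x
    have sgs: "signed k (c *s a) = c *s signed k a" "signed k (a + b) = signed k a + signed k b" for k c a and b :: 'v
      by (simp_all add: signed_def)
    show "lin (\<lambda>v. plug \<beta> m n P Q (v ## x))"
      unfolding rec lin_iff
      by (simp add: contract_lin_add[OF P] contract_lin_add[OF Q] contract_lin_scale[OF P]
          contract_lin_scale[OF Q] plug_add_left[OF Q] plug_add_right plug_scale_left[OF Q]
          plug_scale_right lin_add[OF assms(3)] lin_scale[OF assms(3)] sgs scale_right_distrib add_ac)
  next
    fix v x assume "0 < N"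
    then have N: "m + n - 1 = Suc N" "m + n \<ge> 3" using Suc(2) by auto
    have l: "plug \<beta> (m - 1) n (contract m v P) Q (v ## x) =
        signed m (plug \<beta> (m - 1) (n - 1) (contract m v P) (contract n (\<beta> v) Q) x)"
    proof (cases "m = 0")
      case True
      then show ?thesis
        using plug_zero_left[OF Q] plug_zero_left[OF cQ] by (simp add: contract_0)
    next
      case False
      then show ?thesis
        using plug_scons[OF cP Q, of \<beta> v v x] N
        by (simp add: contract_contract[OF P] plug_zero_left[OF Q])
    qed
    have r: "plug \<beta> m (n - 1) P (contract n (\<beta> v) Q) (v ## x) =
        plug \<beta> (m - 1) (n - 1) (contract m v P) (contract n (\<beta> v) Q) x"
    proof (cases "n = 0")
      case True
      then show ?thesis by simp
    next
      case False
      then show ?thesis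
        using plug_scons[OF P cQ, of \<beta> "\<beta> v" v x] N
        by (simp add: contract_contract[OF Q] plug_zero_right)
    qed
    show "plug \<beta> m n P Q (v ## v ## x) = 0"
      unfolding rec l r by (simp add: signed_def)
  qed
  then show ?case using Suc(2) by simp
qed

end

section \<open>The graded pre-Lie identity\<close>

context cochain_space
begin

lemma plug_m_1: "plug \<beta> m 1 P Q x = Q (P x ## (\<lambda>j. \<beta> (x (m + j))))"
  by (simp add: plug_def shuffle_sum_n_0)

lemma plug_0_n: "0 < n \<Longrightarrow> plug \<beta> 0 n P Q x = Q (P x ## (\<lambda>j. \<beta> (x j)))"
  by (simp add: plug_def shuffle_sum_m_0)

text \<open>Here \<open>\<delta>\<close> stands for the common value of \<open>\<beta> \<circ> \<gamma>\<close> and \<open>\<gamma> \<circ> \<beta>\<close>: an argument that bypasses both \<open>P\<close> and \<open>Q\<close> is hit by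
  both twists.\<close>
definition associator ::
    "('v \<Rightarrow> 'v) \<Rightarrow> ('v \<Rightarrow> 'v) \<Rightarrow> ('v \<Rightarrow> 'v) \<Rightarrow> nat \<Rightarrow> nat \<Rightarrow> nat \<Rightarrow>
     'v cochain \<Rightarrow> 'v cochain \<Rightarrow> 'v cochain \<Rightarrow> 'v cochain" where
  "associator \<beta> \<gamma> \<delta> p q r P Q R =
     plug \<beta> p (q + r - 1) P (plug \<gamma> q r Q R) - plug \<delta> (p + q - 1) r (plug \<beta> p q P Q) R"

lemma associator_zero:
  assumes "Q \<in> alternating q" "R \<in> alternating r" "lin \<gamma>"
  shows "associator \<beta> \<gamma> \<delta> p q r 0 Q R = 0"
    and "associator \<beta> \<gamma> \<delta> p q r P 0 R = 0"
    and "associator \<beta> \<gamma> \<delta> p q r P Q 0 = 0"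
  using assms
  by (simp_all add: associator_def plug_zero_left plug_zero_right plug_alternating)

text \<open>Contraction is a graded derivation of the associator, since it is one of insertion.  Subtraction of arities is truncated,
  so the arities on the two sides can differ when \<open>p\<close>, \<open>q\<close> or \<open>r\<close> is 0, but then the cochain in question is 0.\<close>
lemma associator_scons:
  assumes P: "P \<in> alternating p" and Q: "Q \<in> alternating q" and R: "R \<in> alternating r"
    and lin: "lin \<beta>" "lin \<gamma>" and comm: "\<gamma> (\<beta> v) = \<delta> v"
    and ge: "3 \<le> p + q + r"
  shows "associator \<beta> \<gamma> \<delta> p q r P Q R (v ## x) =
    associator \<beta> \<gamma> \<delta> (p - 1) q r (contract p v P) Q R x
    + signed (p + 1) (associator \<beta> \<gamma> \<delta> p (q - 1) r P (contract q (\<beta> v) Q) R x)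
    + signed (p + q) (associator \<beta> \<gamma> \<delta> p q (r - 1) P Q (contract r (\<delta> v) R) x)"
proof (cases "r = 0")
  case True
  then show ?thesis by (simp add: associator_def plug_zero_right)
next
  case False
  define G where "G = plug \<gamma> q r Q R"
  define H where "H = plug \<beta> p q P Q"
  let ?cP = "contract p v P" and ?cQ = "contract q (\<beta> v) Q" and ?cR = "contract r (\<delta> v) R"
  have G: "G \<in> alternating (q + r - 1)" unfolding G_def by (rule plug_alternating[OF Q R lin(2)])
  have H: "H \<in> alternating (p + q - 1)" unfolding H_def by (rule plug_alternating[OF P Q lin(1)])
  have cR: "?cR \<in> alternating (r - 1)" by (rule contract_alternating[OF R])
  have "2 \<le> p + (q + r - 1)" "2 \<le> (p + q - 1) + r" using ge by linarith+
  note ge2 = this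
  have cG: "contract (q + r - 1) (\<beta> v) G = plug \<gamma> (q - 1) r ?cQ R + signed (q + 1) (plug \<gamma> q (r - 1) Q ?cR)"
    unfolding G_def contract_plug[OF Q R] comm ..
  have cH: "contract (p + q - 1) v H = plug \<beta> (p - 1) q ?cP Q + signed (p + 1) (plug \<beta> p (q - 1) P ?cQ)"
    unfolding H_def contract_plug[OF P Q] ..
  have q_shift: "plug \<beta> p (q + r - 1 - 1) P (plug \<gamma> (q - 1) r ?cQ R)
      = plug \<beta> p (q - 1 + r - 1) P (plug \<gamma> (q - 1) r ?cQ R)"
    by (cases "q = 0") (simp_all add: contract_0 plug_zero_left[OF R] plug_zero_right)
  have r_shift: "q + r - 1 - 1 = q + (r - 1) - 1" using False by linarith
  have p_shift: "plug \<delta> (p + q - 1 - 1) r (plug \<beta> (p - 1) q ?cP Q) R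
      = plug \<delta> (p - 1 + q - 1) r (plug \<beta> (p - 1) q ?cP Q) R"
    by (cases "p = 0") (simp_all add: contract_0 plug_zero_left[OF Q] plug_zero_left[OF R])
  have pq_shift: "plug \<delta> (p + q - 1 - 1) r (plug \<beta> p (q - 1) P ?cQ) R
      = plug \<delta> (p + (q - 1) - 1) r (plug \<beta> p (q - 1) P ?cQ) R"
    by (cases "q = 0") (simp_all add: plug_zero_left[OF R])
  have sign: "signed (p + q - 1 + 1) (plug \<delta> (p + q - 1) (r - 1) H ?cR x)
      = signed (p + q) (plug \<delta> (p + q - 1) (r - 1) H ?cR x)"
  proof (cases "p + q = 0")
    case True
    then show ?thesis using plug_zero_left[OF cR] by (simp add: H_def)
  next
    case False
    then have "p + q - 1 + 1 = p + q" by linarith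
    then show ?thesis by (simp only:)
  qed
  have "plug \<beta> p (q + r - 1) P G (v ## x) =
      plug \<beta> (p - 1) (q + r - 1) ?cP G x
      + signed (p + 1) (plug \<beta> p (q - 1 + r - 1) P (plug \<gamma> (q - 1) r ?cQ R) x)
      + signed (p + 1) (signed (q + 1) (plug \<beta> p (q + (r - 1) - 1) P (plug \<gamma> q (r - 1) Q ?cR) x))"
    unfolding plug_scons[OF P G ge2(1)] cG plug_add_right plug_signed_right q_shift
    unfolding r_shift plus_fun_apply signed_apply signed_add by (simp only: add.assoc)
  moreover have "plug \<delta> (p + q - 1) r H R (v ## x) =
      plug \<delta> (p - 1 + q - 1) r (plug \<beta> (p - 1) q ?cP Q) R x
      + signed (p + 1) (plug \<delta> (p + (q - 1) - 1) r (plug \<beta> p (q - 1) P ?cQ) R x)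
      + signed (p + q) (plug \<delta> (p + q - 1) (r - 1) H ?cR x)"
    unfolding plug_scons[OF H R ge2(2)] cH plug_add_left[OF R] plug_signed_left[OF R] p_shift pq_shift
      plus_fun_apply signed_apply signed_add sign ..
  ultimately show ?thesis
    unfolding associator_def G_def[symmetric] H_def[symmetric] minus_apply
    by (simp add: signed_diff signed_signed signed_def)
qed

text \<open>Both sides obey the same Leibniz rule, so only the cases with no argument left to contract need an inspection.
  When \<open>R\<close> has one argument both associators vanish; the essential case is \<open>R\<close> with two arguments and \<open>P\<close>, \<open>Q\<close> with
  none, where the identity says that \<open>R\<close> is antisymmetric.
  The equations between \<open>P\<close> and \<open>P'\<close> and between \<open>Q\<close> and \<open>Q'\<close> replace commutation with the twists.\<close>
lemma associator_symmetric:
  assumes "P \<in> alternating p" "P' \<in> alternating p" "Q \<in> alternating q" "Q' \<in> alternating q"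
    "R \<in> alternating r"
    and lin: "lin \<beta>" "lin \<gamma>"
    and comm: "\<And>v. \<gamma> (\<beta> v) = \<delta> v" "\<And>v. \<beta> (\<gamma> v) = \<delta> v"
    and "\<And>x. Q (\<lambda>i. \<beta> (x i)) = \<beta> (Q' x)" "\<And>x. P' (\<lambda>i. \<gamma> (x i)) = \<gamma> (P x)"
  shows "associator \<beta> \<gamma> \<delta> p q r P Q R = signed ((p + 1) * (q + 1)) (associator \<gamma> \<beta> \<delta> q p r Q' P' R)"
  using assms(1-5,10,11)
proof (induction "p + q + r" arbitrary: p q r P P' Q Q' R rule: less_induct)
  case less
  note P = less.prems(1) and P' = less.prems(2) and Q = less.prems(3) and Q' = less.prems(4)
    and R = less.prems(5) and eqQ = less.prems(6) and eqP = less.prems(7)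
  consider "r = 0" | "r = 1" "p + q \<le> 1" | "r = 2" "p = 0" "q = 0" | "3 \<le> p + q + r" by linarith
  then show ?case
  proof cases
    case 1
    then show ?thesis by (simp add: associator_def plug_zero_right)
  next
    case 2
    have R': "R (a ## y) = R (a ## z)" for a y z
      using alternating_local[OF R, of "a ## y" "a ## z"] 2 by simp
    have zero: "associator \<beta> \<gamma> \<delta> p q 1 P Q R = 0" if le: "p + q \<le> 1" for \<beta> \<gamma> p q P Q
    proof -
      consider "q = 0" | "p = 0" "q = 1" using le by linarith
      then show ?thesis
      proof cases
        case 1
        then show ?thesis
          using plug_zero_left[OF R] 2 by (simp add: associator_def)
      next
        case 2
        have "plug \<beta> 0 1 P (plug \<gamma> 1 1 Q R) x = plug \<delta> 0 1 (plug \<beta> 0 1 P Q) R x" for x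
          unfolding plug_m_1 using R' by simp
        then show ?thesis using 2 by (simp add: associator_def fun_eq_iff One_nat_def)
      qed
    qed
    show ?thesis using 2 zero[of p q] zero[of q p] by simp
  next
    case 3
    have RR: "R (a ## b ## y) = - R (b ## a ## z)" for a b y z
    proof -
      have "R (a ## b ## y) = - R (b ## a ## y)" by (rule alternating_swap[OF R]) (simp add: 3)
      also have "R (b ## a ## y) = R (b ## a ## z)"
      proof (rule alternating_local[OF R])
        fix i assume "i < r"
        then have "i = 0 \<or> i = 1" using 3 by linarith
        then show "(b ## a ## y) i = (b ## a ## z) i" by auto
      qed
      finally show ?thesis .
    qed
    have Q0: "Q y = \<beta> (Q' x)" for x y
      using alternating_local[OF Q, of y "\<lambda>i. \<beta> (x i)"] eqQ 3 by simp
    have P0: "P' y = \<gamma> (P x)" for x y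
      using alternating_local[OF P', of y "\<lambda>i. \<gamma> (x i)"] eqP 3 by simp
    have "plug \<beta> 0 1 P (plug \<gamma> 0 2 Q R) x = - plug \<gamma> 0 1 Q' (plug \<beta> 0 2 P' R) x" for x
      by (simp add: plug_0_n comp_scons Q0[of _ x] P0[of _ x]) (rule RR)
    moreover have "plug \<delta> 0 2 0 R = 0" using plug_zero_left[OF R] 3 by simp
    ultimately show ?thesis using 3 by (simp add: associator_def fun_eq_iff signed_def One_nat_def numeral_2_eq_2)
  next
    case 4
    have "associator \<beta> \<gamma> \<delta> p q r P Q R (v ## x)
        = signed ((p + 1) * (q + 1)) (associator \<gamma> \<beta> \<delta> q p r Q' P' R) (v ## x)" for v x
    proof -
      note cP = contract_alternating[OF P, of v] and cP' = contract_alternating[OF P', of "\<gamma> v"]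
        and cQ = contract_alternating[OF Q, of "\<beta> v"] and cQ' = contract_alternating[OF Q', of v]
        and cR = contract_alternating[OF R, of "\<delta> v"]
      \<comment> \<open>Contracting with \<open>\<beta> v\<close> on one side and with \<open>v\<close> on the other keeps the relation between the two cochains.\<close>
      have ccQ: "contract q (\<beta> v) Q (\<lambda>i. \<beta> (x i)) = \<beta> (contract q v Q' x)" for x
        using eqQ[of "v ## x"] lin_zero[OF lin(1)] by (simp add: contract_def comp_scons)
      have ccP: "contract p (\<gamma> v) P' (\<lambda>i. \<gamma> (x i)) = \<gamma> (contract p v P x)" for x
        using eqP[of "v ## x"] lin_zero[OF lin(2)] by (simp add: contract_def comp_scons)
      have A: "associator \<beta> \<gamma> \<delta> (p - 1) q r (contract p v P) Q R
          = signed (p * (q + 1)) (associator \<gamma> \<beta> \<delta> q (p - 1) r Q' (contract p (\<gamma> v) P') R)"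
      proof (cases "p = 0")
        case True
        then show ?thesis
          using associator_zero[OF Q R lin(2)] associator_zero[OF P' R lin(1)]
          by (simp add: contract_0)
      next
        case False
        then have "p - 1 + q + r < p + q + r" "p - 1 + 1 = p" by linarith+
        then show ?thesis using less.hyps[OF _ cP cP' Q Q' R eqQ ccP] by simp
      qed
      have B: "associator \<beta> \<gamma> \<delta> p (q - 1) r P (contract q (\<beta> v) Q) R
          = signed ((p + 1) * q) (associator \<gamma> \<beta> \<delta> (q - 1) p r (contract q v Q') P' R)"
      proof (cases "q = 0")
        case True
        then show ?thesis
          using associator_zero[OF Q R lin(2)] associator_zero[OF P' R lin(1)]
          by (simp add: contract_0)
      next
        case False
        then have "p + (q - 1) + r < p + q + r" "q - 1 + 1 = q" by linarith+
        then show ?thesis using less.hyps[OF _ P P' cQ cQ' R ccQ eqP] by simp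
      qed
      have C: "associator \<beta> \<gamma> \<delta> p q (r - 1) P Q (contract r (\<delta> v) R)
          = signed ((p + 1) * (q + 1)) (associator \<gamma> \<beta> \<delta> q p (r - 1) Q' P' (contract r (\<delta> v) R))"
      proof (cases "r = 0")
        case True
        then show ?thesis by (simp add: associator_def plug_zero_right)
      next
        case False
        then have "p + q + (r - 1) < p + q + r" by linarith
        then show ?thesis using less.hyps[OF _ P P' Q Q' cR eqQ eqP] by simp
      qed
      have ge: "3 \<le> q + p + r" using 4 by simp
      show ?thesis
        unfolding associator_scons[OF P Q R lin comm(1) 4] signed_apply A B C
          associator_scons[OF Q' P' R lin(2,1) comm(2) ge]
        by (auto simp: signed_def)
    qed
    then show ?thesis by (rule eq_by_scons)
  qed
qed

end

section \<open>The cup product induced by a bilinear product\<close>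

locale bilinear_product = cochain_space scale
  for scale :: "'k::field \<Rightarrow> 'v::ab_group_add \<Rightarrow> 'v" (infixr \<open>*s\<close> 75) +
  fixes bracket :: "'v \<Rightarrow> 'v \<Rightarrow> 'v"
  assumes linear_left: "lin (\<lambda>x. bracket x y)"
    and linear_right: "lin (\<lambda>y. bracket x y)"
begin

lemma bracket_add_left: "bracket (x + x') y = bracket x y + bracket x' y"
  and bracket_scale_left: "bracket (c *s x) y = c *s bracket x y"
  and bracket_zero_left [simp]: "bracket 0 y = 0"
  using lin_add[OF linear_left[of y]] lin_scale[OF linear_left[of y]] lin_zero[OF linear_left[of y]]
  by auto

lemma bracket_add_right: "bracket x (y + y') = bracket x y + bracket x y'"
  and bracket_scale_right: "bracket x (c *s y) = c *s bracket x y"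
  and bracket_zero_right [simp]: "bracket x 0 = 0"
  using lin_add[OF linear_right[of x]] lin_scale[OF linear_right[of x]] lin_zero[OF linear_right[of x]]
  by auto

text \<open>The bracket \<open>[P, Q]\<^sub>C\<close> with arbitrary maps \<open>\<gamma>\<close>, \<open>\<delta>\<close> in place of the powers of \<open>\<alpha>\<close>.\<close>
definition cup ::
    "('v \<Rightarrow> 'v) \<Rightarrow> ('v \<Rightarrow> 'v) \<Rightarrow> nat \<Rightarrow> nat \<Rightarrow> 'v cochain \<Rightarrow> 'v cochain \<Rightarrow> 'v cochain" where
  "cup \<gamma> \<delta> m n P Q = shuffle_sum m n (\<lambda>y. bracket (\<gamma> (P y)) (\<delta> (Q (\<lambda>j. y (m + j)))))"

lemma cup_zero_left: "lin \<gamma> \<Longrightarrow> cup \<gamma> \<delta> m n 0 Q = 0"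
  by (auto simp: cup_def lin_zero shuffle_sum_zero fun_eq_iff)

lemma cup_zero_right: "lin \<delta> \<Longrightarrow> cup \<gamma> \<delta> m n P 0 = 0"
  by (auto simp: cup_def lin_zero shuffle_sum_zero fun_eq_iff)

lemma cup_add_left: "lin \<gamma> \<Longrightarrow> cup \<gamma> \<delta> m n (P + P') Q = cup \<gamma> \<delta> m n P Q + cup \<gamma> \<delta> m n P' Q"
  by (auto simp: cup_def lin_add bracket_add_left shuffle_sum_add fun_eq_iff)

lemma cup_add_right: "lin \<delta> \<Longrightarrow> cup \<gamma> \<delta> m n P (Q + Q') = cup \<gamma> \<delta> m n P Q + cup \<gamma> \<delta> m n P Q'"
  by (auto simp: cup_def lin_add bracket_add_right shuffle_sum_add fun_eq_iff)

lemma cup_scale_left: "lin \<gamma> \<Longrightarrow> cup \<gamma> \<delta> m n (\<lambda>x. c *s P x) Q = (\<lambda>x. c *s cup \<gamma> \<delta> m n P Q x)"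
  by (auto simp: cup_def lin_scale bracket_scale_left shuffle_sum_scale fun_eq_iff)

lemma cup_scale_right: "lin \<delta> \<Longrightarrow> cup \<gamma> \<delta> m n P (\<lambda>x. c *s Q x) = (\<lambda>x. c *s cup \<gamma> \<delta> m n P Q x)"
  by (auto simp: cup_def lin_scale bracket_scale_right shuffle_sum_scale fun_eq_iff)

lemma cup_minus_left: "lin \<gamma> \<Longrightarrow> cup \<gamma> \<delta> m n (- P) Q = - cup \<gamma> \<delta> m n P Q"
  using cup_scale_left[of \<gamma> \<delta> m n "-1" P] by (simp add: fun_Compl_def)

lemma cup_minus_right: "lin \<delta> \<Longrightarrow> cup \<gamma> \<delta> m n P (- Q) = - cup \<gamma> \<delta> m n P Q"
  using cup_scale_right[of \<delta> \<gamma> m n P "-1"] by (simp add: fun_Compl_def)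

lemma cup_signed_left: "lin \<gamma> \<Longrightarrow> cup \<gamma> \<delta> m n (signed k P) Q = signed k (cup \<gamma> \<delta> m n P Q)"
  by (simp add: signed_def cup_minus_left)

lemma cup_signed_right: "lin \<delta> \<Longrightarrow> cup \<gamma> \<delta> m n P (signed k Q) = signed k (cup \<gamma> \<delta> m n P Q)"
  by (simp add: signed_def cup_minus_right)

text \<open>Contraction is a graded derivation of the cup product.\<close>
lemma cup_scons:
  assumes P: "P \<in> alternating m" and lin: "lin \<gamma>" "lin \<delta>" and "0 < m + n"
  shows "cup \<gamma> \<delta> m n P Q (v ## x) =
    cup \<gamma> \<delta> (m - 1) n (contract m v P) Q x + signed m (cup \<gamma> \<delta> m (n - 1) P (contract n v Q) x)"
proof -
  define \<Phi> where "\<Phi> = (\<lambda>y. bracket (\<gamma> (P y)) (\<delta> (Q (\<lambda>j. y (m + j)))))"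
  have "cup \<gamma> \<delta> m n P Q (v ## x) = shuffle_sum m n \<Phi> (v ## x)"
    by (simp add: cup_def \<Phi>_def)
  also have "\<dots> = (if m = 0 then 0 else shuffle_sum (m - 1) n (\<lambda>y. \<Phi> (v ## y)) x) +
      (if n = 0 then 0 else signed m (shuffle_sum m (n - 1) (\<lambda>y. \<Phi> (insert_at m v y)) x))"
    by (rule shuffle_sum_scons) fact
  also have "(if m = 0 then 0 else shuffle_sum (m - 1) n (\<lambda>y. \<Phi> (v ## y)) x)
      = cup \<gamma> \<delta> (m - 1) n (contract m v P) Q x"
    by (cases m) (simp_all add: contract_def cup_zero_left[OF lin(1)], simp add: cup_def \<Phi>_def)
  also have "(if n = 0 then 0 else signed m (shuffle_sum m (n - 1) (\<lambda>y. \<Phi> (insert_at m v y)) x))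
      = signed m (cup \<gamma> \<delta> m (n - 1) P (contract n v Q) x)"
  proof -
    have "P (insert_at m v y) = P y" for y
      by (rule alternating_local[OF P]) (simp add: insert_at_def)
    then have "\<Phi> (insert_at m v y) = bracket (\<gamma> (P y)) (\<delta> (Q (v ## (\<lambda>j. y (m + j)))))" for y
      by (simp add: \<Phi>_def insert_at_shift)
    then show ?thesis
      by (cases n) (simp_all add: contract_def cup_zero_right[OF lin(2)], simp add: cup_def)
  qed
  finally show ?thesis .
qed

lemma contract_cup:
  assumes P: "P \<in> alternating m" and lin: "lin \<gamma>" "lin \<delta>"
  shows "contract (m + n) v (cup \<gamma> \<delta> m n P Q) =
    cup \<gamma> \<delta> (m - 1) n (contract m v P) Q + signed m (cup \<gamma> \<delta> m (n - 1) P (contract n v Q))"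
proof (cases "m + n = 0")
  case True
  then show ?thesis by (simp add: contract_0 cup_zero_left[OF lin(1)] cup_zero_right[OF lin(2)])
next
  case False
  then have "0 < m + n" by simp
  from cup_scons[OF P lin this] False show ?thesis
    unfolding contract_def[of "m + n"] by (simp only: if_False) (simp add: fun_eq_iff)
qed

lemma cup_alternating:
  assumes "P \<in> alternating m" "Q \<in> alternating n" and lin: "lin \<gamma>" "lin \<delta>"
  shows "cup \<gamma> \<delta> m n P Q \<in> alternating (m + n)"
  using assms(1,2)
proof (induction "m + n" arbitrary: m n P Q)
  case 0
  have "P x = P y" "Q x = Q y" for x y
    using alternating_local[OF 0(2), of x y] alternating_local[OF 0(3), of x y] 0(1) by simp_all
  then have "bracket (\<gamma> (P x)) (\<delta> (Q z)) = bracket (\<gamma> (P y)) (\<delta> (Q w))" for x y z w by metis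
  then show ?case
    using 0(1) by (simp add: cup_def shuffle_sum_0_0 alternating_def)
next
  case (Suc N)
  note P = Suc(3) and Q = Suc(4)
  have pos: "0 < m + n" using Suc(2) by linarith
  note rec = cup_scons[OF P lin pos]
  have cP: "contract m v P \<in> alternating (m - 1)" for v by (rule contract_alternating[OF P])
  have cQ: "contract n v Q \<in> alternating (n - 1)" for v by (rule contract_alternating[OF Q])
  have left: "cup \<gamma> \<delta> (m - 1) n (contract m v P) Q \<in> alternating N" for v
  proof (cases "m = 0")
    case True
    have "cup \<gamma> \<delta> (m - 1) n (contract m v P) Q = 0"
      unfolding True contract_0 by (rule cup_zero_left[OF lin(1)])
    then show ?thesis by (simp only: zero_alternating)
  next
    case False
    then have N: "N = (m - 1) + n" using Suc(2) by linarith
    show ?thesis using Suc(1)[OF N cP Q] N by simp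
  qed
  have right: "cup \<gamma> \<delta> m (n - 1) P (contract n v Q) \<in> alternating N" for v
  proof (cases "n = 0")
    case True
    have "cup \<gamma> \<delta> m (n - 1) P (contract n v Q) = 0"
      unfolding True contract_0 by (rule cup_zero_right[OF lin(2)])
    then show ?thesis by (simp only: zero_alternating)
  next
    case False
    then have N: "N = m + (n - 1)" using Suc(2) by linarith
    show ?thesis using Suc(1)[OF N P cQ] N by simp
  qed
  have "cup \<gamma> \<delta> m n P Q \<in> alternating (Suc N)"
  proof (rule alternating_SucI)
    fix v
    have "(\<lambda>x. cup \<gamma> \<delta> m n P Q (v ## x)) = cup \<gamma> \<delta> (m - 1) n (contract m v P) Q
        + signed m (cup \<gamma> \<delta> m (n - 1) P (contract n v Q))"
      by (auto simp: rec)
    then show "(\<lambda>x. cup \<gamma> \<delta> m n P Q (v ## x)) \<in> alternating N"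
      using left right by (simp add: add_alternating signed_alternating)
  next
    fix x
    have sgs: "signed k (c *s a) = c *s signed k a" for k c a
      by (simp add: signed_def)
    show "lin (\<lambda>v. cup \<gamma> \<delta> m n P Q (v ## x))"
      unfolding rec lin_iff
      by (simp add: contract_lin_add[OF P] contract_lin_add[OF Q] contract_lin_scale[OF P]
          contract_lin_scale[OF Q] cup_add_left[OF lin(1)] cup_add_right[OF lin(2)]
          cup_scale_left[OF lin(1)] cup_scale_right[OF lin(2)] sgs signed_add scale_right_distrib add_ac)
  next
    fix v x assume "0 < N"
    then have N: "m + n \<ge> 2" using Suc(2) by linarith
    have l: "cup \<gamma> \<delta> (m - 1) n (contract m v P) Q (v ## x) =
        signed (m + 1) (cup \<gamma> \<delta> (m - 1) (n - 1) (contract m v P) (contract n v Q) x)"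
    proof (cases "m = 0")
      case True
      then show ?thesis by (simp add: contract_0 cup_zero_left[OF lin(1)])
    next
      case False
      have "0 < m - 1 + n" using N False by linarith
      from cup_scons[OF cP lin this, of v Q v x] False show ?thesis
        by (simp add: contract_contract[OF P] cup_zero_left[OF lin(1)] signed_def)
    qed
    have r: "cup \<gamma> \<delta> m (n - 1) P (contract n v Q) (v ## x) =
        cup \<gamma> \<delta> (m - 1) (n - 1) (contract m v P) (contract n v Q) x"
    proof (cases "n = 0")
      case True
      then show ?thesis by (simp add: contract_0 cup_zero_right[OF lin(2)])
    next
      case False
      have "0 < m + (n - 1)" using N False by linarith
      from cup_scons[OF P lin this, of "contract n v Q" v x] show ?thesis
        by (simp add: contract_contract[OF Q] cup_zero_right[OF lin(2)])
    qed
    show "cup \<gamma> \<delta> m n P Q (v ## v ## x) = 0"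
      unfolding rec l r by (simp add: signed_def)
  qed
  then show ?case using Suc(2) by simp
qed

text \<open>Contraction reduces the claim to cochains without arguments, where it is the antisymmetry of the product.\<close>
lemma cup_skew:
  assumes skew: "\<And>x y. bracket x y = - bracket y x"
    and "P \<in> alternating p" "Q \<in> alternating q" and lin: "lin \<gamma>" "lin \<delta>"
  shows "cup \<gamma> \<delta> p q P Q = - signed (p * q) (cup \<delta> \<gamma> q p Q P)"
  using assms(2,3)
proof (induction "p + q" arbitrary: p q P Q rule: less_induct)
  case less
  note P = less.prems(1) and Q = less.prems(2)
  show ?case
  proof (cases "p + q = 0")
    case True
    then have "p = 0" "q = 0" by simp_all
    then show ?thesis
      using skew[of "\<gamma> (P _)"] by (auto simp: cup_def shuffle_sum_0_0 fun_eq_iff signed_def)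
  next
    case False
    then have pos: "0 < p + q" "0 < q + p" by linarith+
    have "cup \<gamma> \<delta> p q P Q (v ## x) = (- signed (p * q) (cup \<delta> \<gamma> q p Q P)) (v ## x)" for v x
    proof -
      note cP = contract_alternating[OF P, of v] and cQ = contract_alternating[OF Q, of v]
      have A: "cup \<gamma> \<delta> (p - 1) q (contract p v P) Q
          = - signed ((p + 1) * q) (cup \<delta> \<gamma> q (p - 1) Q (contract p v P))"
      proof (cases "p = 0")
        case True
        then show ?thesis by (simp add: contract_0 cup_zero_left[OF lin(1)] cup_zero_right[OF lin(1)])
      next
        case False
        then have "p - 1 + q < p + q" by linarith
        then show ?thesis using less.hyps[OF _ cP Q] False by (simp add: signed_def)
      qed
      have B: "cup \<gamma> \<delta> p (q - 1) P (contract q v Q)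
          = - signed (p * (q + 1)) (cup \<delta> \<gamma> (q - 1) p (contract q v Q) P)"
      proof (cases "q = 0")
        case True
        then show ?thesis by (simp add: contract_0 cup_zero_left[OF lin(2)] cup_zero_right[OF lin(2)])
      next
        case False
        then have "p + (q - 1) < p + q" by linarith
        then show ?thesis using less.hyps[OF _ P cQ] False by (simp add: signed_def)
      qed
      show ?thesis
        unfolding cup_scons[OF P lin pos(1)] uminus_apply signed_apply A B
          cup_scons[OF Q lin(2,1) pos(2)]
        by (auto simp: signed_def)
    qed
    then show ?thesis by (rule eq_by_scons)
  qed
qed

text \<open>Contraction reduces the claim to cochains without arguments, where it is the hypothesis on the product.  The twists
  are unrelated linear maps because contraction does not touch them.\<close>
lemma cup_jacobi:
  assumes jac: "\<And>x y z. bracket (a x) (b (bracket (c y) (d z))) =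
      bracket (a' (bracket (c' x) (d' y))) (b' z) + bracket (a'' y) (b'' (bracket (c'' x) (d'' z)))"
    and lin: "lin a" "lin b" "lin c" "lin d" "lin a'" "lin b'" "lin c'" "lin d'"
      "lin a''" "lin b''" "lin c''" "lin d''"
    and "P \<in> alternating p" "Q \<in> alternating q" "R \<in> alternating r"
  shows "cup a b p (q + r) P (cup c d q r Q R) = cup a' b' (p + q) r (cup c' d' p q P Q) R
    + signed (p * q) (cup a'' b'' q (p + r) Q (cup c'' d'' p r P R))"
  using assms(14-16)
proof (induction "p + q + r" arbitrary: p q r P Q R rule: less_induct)
  case less
  note P = less.prems(1) and Q = less.prems(2) and R = less.prems(3)
  note zeros = contract_0 cup_zero_left[OF lin(1)] cup_zero_left[OF lin(3)]
    cup_zero_left[OF lin(5)] cup_zero_left[OF lin(7)]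
    cup_zero_left[OF lin(9)] cup_zero_left[OF lin(11)]
    cup_zero_right[OF lin(2)] cup_zero_right[OF lin(4)] cup_zero_right[OF lin(6)]
    cup_zero_right[OF lin(8)] cup_zero_right[OF lin(10)] cup_zero_right[OF lin(12)]
  show ?case
  proof (cases "p + q + r = 0")
    case True
    then have 0: "p = 0" "q = 0" "r = 0" by simp_all
    show ?thesis
      using jac by (auto simp: 0 cup_def shuffle_sum_0_0 fun_eq_iff signed_def)
  next
    case False
    have "cup a b p (q + r) P (cup c d q r Q R) (v ## x) =
      (cup a' b' (p + q) r (cup c' d' p q P Q) R
        + signed (p * q) (cup a'' b'' q (p + r) Q (cup c'' d'' p r P R))) (v ## x)" for v x
    proof -
      let ?cP = "contract p v P" and ?cQ = "contract q v Q" and ?cR = "contract r v R"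
      note cP = contract_alternating[OF P, of v] and cQ = contract_alternating[OF Q, of v]
        and cR = contract_alternating[OF R, of v]
      have shift: "cup a b p (q + r - 1) P (cup c d (q - 1) r ?cQ R) =
            cup a b p (q - 1 + r) P (cup c d (q - 1) r ?cQ R)"
          "cup a b p (q + r - 1) P (cup c d q (r - 1) Q ?cR) =
            cup a b p (q + (r - 1)) P (cup c d q (r - 1) Q ?cR)"
          "cup a' b' (p + q - 1) r (cup c' d' (p - 1) q ?cP Q) R =
            cup a' b' (p - 1 + q) r (cup c' d' (p - 1) q ?cP Q) R"
          "cup a' b' (p + q - 1) r (cup c' d' p (q - 1) P ?cQ) R =
            cup a' b' (p + (q - 1)) r (cup c' d' p (q - 1) P ?cQ) R"
          "cup a'' b'' q (p + r - 1) Q (cup c'' d'' (p - 1) r ?cP R) =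
            cup a'' b'' q (p - 1 + r) Q (cup c'' d'' (p - 1) r ?cP R)"
          "cup a'' b'' q (p + r - 1) Q (cup c'' d'' p (r - 1) P ?cR) =
            cup a'' b'' q (p + (r - 1)) Q (cup c'' d'' p (r - 1) P ?cR)"
        by (cases p; cases q; cases r; simp add: zeros)+
      have pos: "0 < p + (q + r)" "0 < p + q + r" "0 < q + (p + r)" using False by linarith+
      have A: "cup a b (p - 1) (q + r) ?cP (cup c d q r Q R)
          = cup a' b' (p - 1 + q) r (cup c' d' (p - 1) q ?cP Q) R
          + signed ((p + 1) * q) (cup a'' b'' q (p - 1 + r) Q (cup c'' d'' (p - 1) r ?cP R))"
      proof (cases "p = 0")
        case True
        then show ?thesis by (simp add: zeros)
      next
        case False
        then have "p - 1 + q + r < p + q + r" by linarith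
        then show ?thesis using less.hyps[OF _ cP Q R] False by (simp add: signed_def)
      qed
      have B: "cup a b p (q - 1 + r) P (cup c d (q - 1) r ?cQ R)
          = cup a' b' (p + (q - 1)) r (cup c' d' p (q - 1) P ?cQ) R
          + signed (p * (q + 1)) (cup a'' b'' (q - 1) (p + r) ?cQ (cup c'' d'' p r P R))"
      proof (cases "q = 0")
        case True
        then show ?thesis by (simp add: zeros)
      next
        case False
        then have "p + (q - 1) + r < p + q + r" by linarith
        then show ?thesis using less.hyps[OF _ P cQ R] False by (simp add: signed_def)
      qed
      have C: "cup a b p (q + (r - 1)) P (cup c d q (r - 1) Q ?cR)
          = cup a' b' (p + q) (r - 1) (cup c' d' p q P Q) ?cR
          + signed (p * q) (cup a'' b'' q (p + (r - 1)) Q (cup c'' d'' p (r - 1) P ?cR))"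
      proof (cases "r = 0")
        case True
        then show ?thesis by (simp add: zeros)
      next
        case False
        then have "p + q + (r - 1) < p + q + r" by linarith
        then show ?thesis using less.hyps[OF _ P Q cR] by simp
      qed
      have L: "cup a b p (q + r) P (cup c d q r Q R) (v ## x) =
          cup a b (p - 1) (q + r) ?cP (cup c d q r Q R) x
          + signed p (cup a b p (q - 1 + r) P (cup c d (q - 1) r ?cQ R) x)
          + signed (p + q) (cup a b p (q + (r - 1)) P (cup c d q (r - 1) Q ?cR) x)"
        unfolding cup_scons[OF P lin(1,2) pos(1)] contract_cup[OF Q lin(3,4)] cup_add_right[OF lin(2)]
          cup_signed_right[OF lin(2)] shift plus_fun_apply signed_apply signed_add signed_signed by (simp only: add.assoc)
      have M: "cup a' b' (p + q) r (cup c' d' p q P Q) R (v ## x) =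
          cup a' b' (p - 1 + q) r (cup c' d' (p - 1) q ?cP Q) R x
          + signed p (cup a' b' (p + (q - 1)) r (cup c' d' p (q - 1) P ?cQ) R x)
          + signed (p + q) (cup a' b' (p + q) (r - 1) (cup c' d' p q P Q) ?cR x)"
        unfolding cup_scons[OF cup_alternating[OF P Q lin(7,8)] lin(5,6) pos(2)] contract_cup[OF P lin(7,8)]
          cup_add_left[OF lin(5)] cup_signed_left[OF lin(5)] shift plus_fun_apply signed_apply signed_add signed_signed
        by (simp only: add.assoc)
      have N: "cup a'' b'' q (p + r) Q (cup c'' d'' p r P R) (v ## x) =
          cup a'' b'' (q - 1) (p + r) ?cQ (cup c'' d'' p r P R) x
          + signed q (cup a'' b'' q (p - 1 + r) Q (cup c'' d'' (p - 1) r ?cP R) x)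
          + signed (q + p) (cup a'' b'' q (p + (r - 1)) Q (cup c'' d'' p (r - 1) P ?cR) x)"
        unfolding cup_scons[OF Q lin(9,10) pos(3)] contract_cup[OF P lin(11,12)] cup_add_right[OF lin(10)]
          cup_signed_right[OF lin(10)] shift plus_fun_apply signed_apply signed_add signed_signed by (simp only: add.assoc)
      show ?thesis
        unfolding plus_fun_apply signed_apply L M N A B C by (auto simp: signed_def)
    qed
    then show ?thesis by (rule eq_by_scons)
  qed
qed

end

section \<open>Insertion is a derivation of the cup product\<close>

context bilinear_product
begin

text \<open>All three terms obey the same Leibniz rule.  If \<open>Q\<close> and \<open>R\<close> have no arguments, or if there is at most one argument in
  total, the claim is read off from the definitions.  On the right, an argument of the factor without \<open>P\<close> has bypassed \<open>P\<close>, so it is hit by \<open>\<beta>\<close>: the factor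
  \<open>R\<close> becomes \<open>R \<circ> \<beta> = \<beta> \<circ> R'\<close>, and \<open>\<beta>\<close> is absorbed in the outer twist \<open>\<delta>'\<close>.\<close>
lemma plug_cup_derivation:
  assumes "P \<in> alternating p" "Q \<in> alternating q" "Q' \<in> alternating q"
    "R \<in> alternating r" "R' \<in> alternating r"
    and lin: "lin \<beta>" "lin \<gamma>" "lin \<delta>" "lin \<gamma>'" "lin \<delta>'"
    and comp: "\<And>v. \<gamma> (\<beta> v) = \<gamma>' v" "\<And>v. \<delta> (\<beta> v) = \<delta>' v"
    and "\<And>x. Q (\<lambda>i. \<beta> (x i)) = \<beta> (Q' x)" "\<And>x. R (\<lambda>i. \<beta> (x i)) = \<beta> (R' x)"
  shows "plug \<beta> p (q + r) P (cup \<gamma> \<delta> q r Q R) =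
    cup \<gamma> \<delta>' (p + q - 1) r (plug \<beta> p q P Q) R'
    + signed ((p + 1) * q) (cup \<gamma>' \<delta> q (p + r - 1) Q' (plug \<beta> p r P R))"
  using assms(1-5,13,14)
proof (induction "p + q + r" arbitrary: p q r P Q Q' R R' rule: less_induct)
  case less
  note P = less.prems(1) and Q = less.prems(2) and Q' = less.prems(3)
    and R = less.prems(4) and R' = less.prems(5) and eqQ = less.prems(6) and eqR = less.prems(7)
  let ?X = "cup \<gamma> \<delta> q r Q R"
  have X: "?X \<in> alternating (q + r)" by (rule cup_alternating[OF Q R lin(2,3)])
  have PQ: "plug \<beta> p q P Q \<in> alternating (p + q - 1)" by (rule plug_alternating[OF P Q lin(1)])
  note zeros = contract_0 plug_zero_right plug_zero_left[OF X] plug_zero_left[OF Q] plug_zero_left[OF R]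
    cup_zero_left[OF lin(2)] cup_zero_left[OF lin(4)]
    cup_zero_right[OF lin(3)] cup_zero_right[OF lin(5)]
  consider "q = 0" "r = 0" | "p = 0" "q = 1" "r = 0" | "p = 0" "q = 0" "r = 1"
    | "2 \<le> p + q + r" by linarith
  then show ?case
  proof cases
    case 1
    then show ?thesis using plug_n_0 by (simp add: zeros)
  next
    case 2
    have R0: "R y = \<beta> (R' x)" for x y
      using alternating_local[OF R, of y "\<lambda>i. \<beta> (x i)"] eqR 2 by simp
    have "plug \<beta> 0 1 P (cup \<gamma> \<delta> 1 0 Q R) x = cup \<gamma> \<delta>' 0 0 (plug \<beta> 0 1 P Q) R' x" for x
      by (simp add: plug_0_n cup_def shuffle_sum_n_0 comp R0[of _ x])
    then show ?thesis using 2 by (simp add: zeros fun_eq_iff)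
  next
    case 3
    have Q0: "Q y = \<beta> (Q' x)" for x y
      using alternating_local[OF Q, of y "\<lambda>i. \<beta> (x i)"] eqQ 3 by simp
    have "plug \<beta> 0 1 P (cup \<gamma> \<delta> 0 1 Q R) x = cup \<gamma>' \<delta> 0 0 Q' (plug \<beta> 0 1 P R) x" for x
      by (simp add: plug_0_n cup_def shuffle_sum_m_0 comp Q0[of _ x])
    then show ?thesis using 3 by (simp add: zeros fun_eq_iff signed_def)
  next
    case 4
    have "plug \<beta> p (q + r) P ?X (v ## x) =
      (cup \<gamma> \<delta>' (p + q - 1) r (plug \<beta> p q P Q) R'
        + signed ((p + 1) * q) (cup \<gamma>' \<delta> q (p + r - 1) Q' (plug \<beta> p r P R))) (v ## x)" for v x
    proof -
      let ?cP = "contract p v P" and ?cQ = "contract q (\<beta> v) Q" and ?cQ' = "contract q v Q'"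
        and ?cR = "contract r (\<beta> v) R" and ?cR' = "contract r v R'"
      note cP = contract_alternating[OF P, of v] and cQ = contract_alternating[OF Q, of "\<beta> v"]
        and cQ' = contract_alternating[OF Q', of v] and cR = contract_alternating[OF R, of "\<beta> v"]
        and cR' = contract_alternating[OF R', of v]
      have ccQ: "?cQ (\<lambda>i. \<beta> (x i)) = \<beta> (?cQ' x)" for x
        using eqQ[of "v ## x"] lin_zero[OF lin(1)] by (simp add: contract_def comp_scons)
      have ccR: "?cR (\<lambda>i. \<beta> (x i)) = \<beta> (?cR' x)" for x
        using eqR[of "v ## x"] lin_zero[OF lin(1)] by (simp add: contract_def comp_scons)
      have A: "plug \<beta> (p - 1) (q + r) ?cP ?X =
          cup \<gamma> \<delta>' (p - 1 + q - 1) r (plug \<beta> (p - 1) q ?cP Q) R'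
          + signed (p * q) (cup \<gamma>' \<delta> q (p - 1 + r - 1) Q' (plug \<beta> (p - 1) r ?cP R))"
      proof (cases "p = 0")
        case True
        then show ?thesis by (simp add: zeros)
      next
        case False
        then have "p - 1 + q + r < p + q + r" "p - 1 + 1 = p" by linarith+
        then show ?thesis using less.hyps[OF _ cP Q Q' R R' eqQ eqR] by simp
      qed
      have B: "plug \<beta> p (q - 1 + r) P (cup \<gamma> \<delta> (q - 1) r ?cQ R) =
          cup \<gamma> \<delta>' (p + (q - 1) - 1) r (plug \<beta> p (q - 1) P ?cQ) R'
          + signed ((p + 1) * (q + 1)) (cup \<gamma>' \<delta> (q - 1) (p + r - 1) ?cQ' (plug \<beta> p r P R))"
      proof (cases "q = 0")
        case True
        then show ?thesis by (simp add: zeros)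
      next
        case False
        then have "p + (q - 1) + r < p + q + r" by linarith
        then show ?thesis using less.hyps[OF _ P cQ cQ' R R' ccQ eqR] False by (simp add: signed_def)
      qed
      have C: "plug \<beta> p (q + (r - 1)) P (cup \<gamma> \<delta> q (r - 1) Q ?cR) =
          cup \<gamma> \<delta>' (p + q - 1) (r - 1) (plug \<beta> p q P Q) ?cR'
          + signed ((p + 1) * q) (cup \<gamma>' \<delta> q (p + (r - 1) - 1) Q' (plug \<beta> p (r - 1) P ?cR))"
      proof (cases "r = 0")
        case True
        then show ?thesis by (simp add: zeros)
      next
        case False
        then have "p + q + (r - 1) < p + q + r" by linarith
        then show ?thesis using less.hyps[OF _ P Q Q' cR cR' eqQ ccR] by simp
      qed
      have s1: "plug \<beta> p (q + r - 1) P (cup \<gamma> \<delta> (q - 1) r ?cQ R)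
          = plug \<beta> p (q - 1 + r) P (cup \<gamma> \<delta> (q - 1) r ?cQ R)"
      proof (cases "q = 0")
        case True
        then show ?thesis by (simp add: zeros)
      next
        case False
        then have "q + r - 1 = q - 1 + r" by linarith
        then show ?thesis by (simp only:)
      qed
      have s2: "plug \<beta> p (q + r - 1) P (cup \<gamma> \<delta> q (r - 1) Q ?cR)
          = plug \<beta> p (q + (r - 1)) P (cup \<gamma> \<delta> q (r - 1) Q ?cR)"
      proof (cases "r = 0")
        case True
        then show ?thesis by (simp add: zeros)
      next
        case False
        then have "q + r - 1 = q + (r - 1)" by linarith
        then show ?thesis by (simp only:)
      qed
      have s3: "cup \<gamma> \<delta>' (p + q - 1 - 1) r (plug \<beta> (p - 1) q ?cP Q) R'
          = cup \<gamma> \<delta>' (p - 1 + q - 1) r (plug \<beta> (p - 1) q ?cP Q) R'"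
      proof (cases "p = 0")
        case True
        then show ?thesis by (simp add: zeros)
      next
        case False
        then have "p + q - 1 - 1 = p - 1 + q - 1" by linarith
        then show ?thesis by (simp only:)
      qed
      have s4: "cup \<gamma> \<delta>' (p + q - 1 - 1) r (plug \<beta> p (q - 1) P ?cQ) R'
          = cup \<gamma> \<delta>' (p + (q - 1) - 1) r (plug \<beta> p (q - 1) P ?cQ) R'"
      proof (cases "q = 0")
        case True
        then show ?thesis by (simp add: zeros)
      next
        case False
        then have "p + q - 1 - 1 = p + (q - 1) - 1" by linarith
        then show ?thesis by (simp only:)
      qed
      have s5: "cup \<gamma>' \<delta> q (p + r - 1 - 1) Q' (plug \<beta> (p - 1) r ?cP R)
          = cup \<gamma>' \<delta> q (p - 1 + r - 1) Q' (plug \<beta> (p - 1) r ?cP R)"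
      proof (cases "p = 0")
        case True
        then show ?thesis by (simp add: zeros)
      next
        case False
        then have "p + r - 1 - 1 = p - 1 + r - 1" by linarith
        then show ?thesis by (simp only:)
      qed
      have s6: "cup \<gamma>' \<delta> q (p + r - 1 - 1) Q' (plug \<beta> p (r - 1) P ?cR)
          = cup \<gamma>' \<delta> q (p + (r - 1) - 1) Q' (plug \<beta> p (r - 1) P ?cR)"
      proof (cases "r = 0")
        case True
        then show ?thesis by (simp add: zeros)
      next
        case False
        then have "p + r - 1 - 1 = p + (r - 1) - 1" by linarith
        then show ?thesis by (simp only:)
      qed
      note shift = s1 s2 s3 s4 s5 s6
      \<comment> \<open>The two exponents have the same parity unless the subtraction is truncated, and then the cochain is 0.\<close>
      have sign: "signed (p + q - 1) (cup \<gamma> \<delta>' (p + q - 1) (r - 1) (plug \<beta> p q P Q) ?cR' x)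
          = signed (p + q + 1) (cup \<gamma> \<delta>' (p + q - 1) (r - 1) (plug \<beta> p q P Q) ?cR' x)"
      proof (cases "p + q = 0")
        case True
        then show ?thesis by (simp add: zeros)
      next
        case False
        then have "p + q + 1 = Suc (Suc (p + q - 1))" by linarith
        then have "even (p + q + 1) = even (p + q - 1)" by (simp only: even_Suc not_not)
        then show ?thesis by (simp only: signed_def)
      qed
      have pos: "2 \<le> p + (q + r)" "0 < p + q - 1 + r" "0 < q + (p + r - 1)" using 4 by linarith+
      have L: "plug \<beta> p (q + r) P ?X (v ## x) = plug \<beta> (p - 1) (q + r) ?cP ?X x
          + signed (p + 1) (plug \<beta> p (q - 1 + r) P (cup \<gamma> \<delta> (q - 1) r ?cQ R) x)
          + signed (p + 1 + q) (plug \<beta> p (q + (r - 1)) P (cup \<gamma> \<delta> q (r - 1) Q ?cR) x)"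
        unfolding plug_scons[OF P X pos(1)] contract_cup[OF Q lin(2,3)] plug_add_right plug_signed_right
          shift plus_fun_apply signed_apply signed_add signed_signed by (simp only: add.assoc)
      have M: "cup \<gamma> \<delta>' (p + q - 1) r (plug \<beta> p q P Q) R' (v ## x) =
          cup \<gamma> \<delta>' (p - 1 + q - 1) r (plug \<beta> (p - 1) q ?cP Q) R' x
          + signed (p + 1) (cup \<gamma> \<delta>' (p + (q - 1) - 1) r (plug \<beta> p (q - 1) P ?cQ) R' x)
          + signed (p + q + 1) (cup \<gamma> \<delta>' (p + q - 1) (r - 1) (plug \<beta> p q P Q) ?cR' x)"
        unfolding cup_scons[OF PQ lin(2,5) pos(2)] contract_plug[OF P Q] cup_add_left[OF lin(2)]
          cup_signed_left[OF lin(2)] shift plus_fun_apply signed_apply signed_add sign ..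
      have N: "cup \<gamma>' \<delta> q (p + r - 1) Q' (plug \<beta> p r P R) (v ## x) =
          cup \<gamma>' \<delta> (q - 1) (p + r - 1) ?cQ' (plug \<beta> p r P R) x
          + signed q (cup \<gamma>' \<delta> q (p - 1 + r - 1) Q' (plug \<beta> (p - 1) r ?cP R) x)
          + signed (q + (p + 1)) (cup \<gamma>' \<delta> q (p + (r - 1) - 1) Q' (plug \<beta> p (r - 1) P ?cR) x)"
        unfolding cup_scons[OF Q' lin(4,3) pos(3)] contract_plug[OF P R] cup_add_right[OF lin(3)]
          cup_signed_right[OF lin(3)] shift plus_fun_apply signed_apply signed_add signed_signed by (simp only: add.assoc)
      show ?thesis
        unfolding plus_fun_apply signed_apply L M N A B C by (auto simp: signed_def)
    qed
    then show ?thesis by (rule eq_by_scons)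
  qed
qed

end

section \<open>The operations on Hom-cochains\<close>

sublocale hom_lie_algebra \<subseteq> bilinear_product scale bracket
  by (intro bilinear_product.intro cochain_space.intro bilinear_product_axioms.intro
      vector_space_axioms bracket_linear_left bracket_linear_right)

context hom_lie_algebra
begin

abbreviation "H \<equiv> hom_cochains scale \<alpha>"
abbreviation "ins \<equiv> insertion scale \<alpha>"
abbreviation "cb \<equiv> c_bracket scale bracket \<alpha>"
abbreviation "th \<equiv> theta scale bracket \<alpha>"
abbreviation "nr \<equiv> nr_bracket scale \<alpha>"
abbreviation "db \<equiv> derived_bracket scale bracket \<alpha>"

definition id_cochain :: "'v cochain" where "id_cochain = (\<lambda>x. x 0)"

lemma H_iff: "f \<in> H n \<longleftrightarrow> f \<in> alternating n \<and> (\<forall>x. \<alpha> (f x) = f (\<lambda>i. \<alpha> (x i)))"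
  by (auto simp: hom_cochains_def alternating_def)

lemma H_alternating: "f \<in> H n \<Longrightarrow> f \<in> alternating n"
  by (simp add: H_iff)

lemma H_alpha: "f \<in> H n \<Longrightarrow> \<alpha> (f x) = f (\<lambda>i. \<alpha> (x i))"
  by (simp add: H_iff)

lemma H_alpha_pow: "f \<in> H n \<Longrightarrow> (\<alpha> ^^ k) (f x) = f (\<lambda>i. (\<alpha> ^^ k) (x i))"
  by (induction k) (simp_all add: H_alpha)

lemma lin_alpha: "lin \<alpha>"
  by (rule alpha_linear)

lemma lin_alpha_pow: "lin (\<alpha> ^^ k)"
  by (induction k) (simp_all add: lin_iff lin_add[OF lin_alpha] lin_scale[OF lin_alpha])

lemma alpha_pow_add: "(\<alpha> ^^ k) ((\<alpha> ^^ l) v) = (\<alpha> ^^ (k + l)) v"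
  by (simp add: funpow_add)

lemma alpha_pow_bracket: "(\<alpha> ^^ k) (bracket u v) = bracket ((\<alpha> ^^ k) u) ((\<alpha> ^^ k) v)"
  by (induction k) (simp_all add: alpha_bracket)

lemma cochain_scale_sign: "cochain_scale scale ((-1) ^ k) f = signed k f"
  by (simp add: cochain_scale_def signed_def fun_eq_iff)

lemma zero_H: "0 \<in> H n"
  by (simp add: H_iff zero_alternating lin_zero[OF lin_alpha])

lemma add_H: "f \<in> H n \<Longrightarrow> g \<in> H n \<Longrightarrow> f + g \<in> H n"
  by (simp add: H_iff add_alternating lin_add[OF lin_alpha])

lemma scale_H: "f \<in> H n \<Longrightarrow> cochain_scale scale c f \<in> H n"
  by (simp add: H_iff cochain_scale_def scale_alternating lin_scale[OF lin_alpha])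

lemma minus_H: "f \<in> H n \<Longrightarrow> - f \<in> H n"
  by (simp add: H_iff minus_alternating lin_minus[OF lin_alpha])

lemma signed_H: "f \<in> H n \<Longrightarrow> signed k f \<in> H n"
  by (simp add: signed_def minus_H)

lemma diff_H: "f \<in> H n \<Longrightarrow> g \<in> H n \<Longrightarrow> f - g \<in> H n"
  using add_H[of f n "- g"] minus_H by simp

lemma ins_eq:
  assumes "0 < q"
  shows "ins p q P Q = plug (\<alpha> ^^ (p - 1)) p q P Q"
proof -
  have "(\<lambda>j. if j = 0 then P (\<lambda>i. x (\<sigma> i)) else (\<alpha> ^^ (p - 1)) (x (\<sigma> (p + j - 1))))
      = P (\<lambda>i. x (\<sigma> i)) ## (\<lambda>j. (\<alpha> ^^ (p - 1)) (x (\<sigma> (p + j))))" for x :: "nat \<Rightarrow> 'v" and \<sigma>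
    by (auto simp: scons_def fun_eq_iff split: nat.split)
  then show ?thesis
    using assms unfolding insertion_def plug_def shuffle_sum_def by (simp only: if_False less_irrefl) auto
qed

lemma cb_eq: "cb p q P Q = cup (\<alpha> ^^ (q - 1)) (\<alpha> ^^ (p - 1)) p q P Q"
  by (simp add: c_bracket_def cup_def shuffle_sum_def fun_eq_iff)

lemma shuffle_sum_alpha:
  assumes "\<And>y. \<alpha> (\<Phi> y) = \<Phi> (\<lambda>i. \<alpha> (y i))"
  shows "\<alpha> (shuffle_sum m n \<Phi> x) = shuffle_sum m n \<Phi> (\<lambda>i. \<alpha> (x i))"
proof -
  have "\<alpha> (sum f A) = (\<Sum>a\<in>A. \<alpha> (f a))" for f and A :: "(nat \<Rightarrow> nat) set"
    by (induction A rule: infinite_finite_induct)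
      (simp_all add: lin_zero[OF lin_alpha] lin_add[OF lin_alpha])
  then show ?thesis
    by (simp add: shuffle_sum_def lin_scale[OF lin_alpha] assms)
qed

lemma alpha_pow_commute: "\<alpha> ((\<alpha> ^^ k) v) = (\<alpha> ^^ k) (\<alpha> v)"
  by (simp add: funpow_swap1)

lemma ins_H:
  assumes P: "P \<in> H p" and Q: "Q \<in> H q" and "0 < q"
  shows "ins p q P Q \<in> H (p + q - 1)"
proof -
  have "\<alpha> (ins p q P Q x) = ins p q P Q (\<lambda>i. \<alpha> (x i))" for x
    unfolding ins_eq[OF \<open>0 < q\<close>] plug_def using \<open>0 < q\<close>
    by (simp, intro shuffle_sum_alpha)
      (simp add: H_alpha[OF P] H_alpha[OF Q] comp_scons alpha_pow_commute)
  then show ?thesis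
    using plug_alternating[OF H_alternating[OF P] H_alternating[OF Q] lin_alpha_pow]
    by (simp add: H_iff ins_eq[OF \<open>0 < q\<close>])
qed

lemma cb_H:
  assumes P: "P \<in> H p" and Q: "Q \<in> H q"
  shows "cb p q P Q \<in> H (p + q)"
proof -
  have "\<alpha> (cb p q P Q x) = cb p q P Q (\<lambda>i. \<alpha> (x i))" for x
    unfolding cb_eq cup_def
    by (intro shuffle_sum_alpha)
      (simp add: H_alpha[OF P] H_alpha[OF Q] alpha_bracket alpha_pow_commute)
  then show ?thesis
    using cup_alternating[OF H_alternating[OF P] H_alternating[OF Q] lin_alpha_pow lin_alpha_pow]
    by (simp add: H_iff cb_eq)
qed

text \<open>A cochain of arity \<open>p\<close> carries the twist \<open>\<alpha> ^^ (p - 1)\<close>, and these exponents add up under insertion.\<close>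
lemma ins_pre_lie:
  assumes P: "P \<in> H p" and Q: "Q \<in> H q" and R: "R \<in> H r" and pos: "0 < p" "0 < q" "0 < r"
  shows "ins p (q + r - 1) P (ins q r Q R) - ins (p + q - 1) r (ins p q P Q) R =
    signed ((p + 1) * (q + 1))
      (ins q (p + r - 1) Q (ins p r P R) - ins (p + q - 1) r (ins q p Q P) R)"
proof -
  have "associator (\<alpha> ^^ (p - 1)) (\<alpha> ^^ (q - 1)) (\<alpha> ^^ (p + q - 1 - 1)) p q r P Q R =
      signed ((p + 1) * (q + 1))
        (associator (\<alpha> ^^ (q - 1)) (\<alpha> ^^ (p - 1)) (\<alpha> ^^ (p + q - 1 - 1)) q p r Q P R)"
  proof (rule associator_symmetric)
    have "q - 1 + (p - 1) = p + q - 1 - 1" "p - 1 + (q - 1) = p + q - 1 - 1"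
      using pos by linarith+
    then show "(\<alpha> ^^ (q - 1)) ((\<alpha> ^^ (p - 1)) v) = (\<alpha> ^^ (p + q - 1 - 1)) v"
      "(\<alpha> ^^ (p - 1)) ((\<alpha> ^^ (q - 1)) v) = (\<alpha> ^^ (p + q - 1 - 1)) v" for v
      by (simp_all only: alpha_pow_add)
  qed (use P Q R in \<open>simp_all add: H_alternating lin_alpha_pow H_alpha_pow\<close>)
  moreover have "0 < q + r - 1" "0 < p + r - 1" using pos by linarith+
  ultimately show ?thesis
    using pos by (simp add: associator_def ins_eq add.commute[of q p])
qed

lemma ins_derivation:
  assumes P: "P \<in> H p" and Q: "Q \<in> H q" and R: "R \<in> H r" and pos: "0 < p" "0 < q" "0 < r"
  shows "ins p (q + r) P (cb q r Q R) =
    cb (p + q - 1) r (ins p q P Q) R + signed ((p + 1) * q) (cb q (p + r - 1) Q (ins p r P R))"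
proof -
  have "plug (\<alpha> ^^ (p - 1)) p (q + r) P (cup (\<alpha> ^^ (r - 1)) (\<alpha> ^^ (q - 1)) q r Q R) =
    cup (\<alpha> ^^ (r - 1)) (\<alpha> ^^ (p + q - 1 - 1)) (p + q - 1) r (plug (\<alpha> ^^ (p - 1)) p q P Q) R
    + signed ((p + 1) * q)
      (cup (\<alpha> ^^ (p + r - 1 - 1)) (\<alpha> ^^ (q - 1)) q (p + r - 1) Q (plug (\<alpha> ^^ (p - 1)) p r P R))"
  proof (rule plug_cup_derivation)
    have "r - 1 + (p - 1) = p + r - 1 - 1" "q - 1 + (p - 1) = p + q - 1 - 1"
      using pos by linarith+
    then show "(\<alpha> ^^ (r - 1)) ((\<alpha> ^^ (p - 1)) v) = (\<alpha> ^^ (p + r - 1 - 1)) v"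
      "(\<alpha> ^^ (q - 1)) ((\<alpha> ^^ (p - 1)) v) = (\<alpha> ^^ (p + q - 1 - 1)) v" for v
      by (simp_all only: alpha_pow_add)
  qed (use P Q R in \<open>simp_all add: H_alternating lin_alpha_pow H_alpha_pow\<close>)
  then show ?thesis
    using pos by (simp add: ins_eq cb_eq)
qed

lemma cb_skew:
  assumes P: "P \<in> H p" and Q: "Q \<in> H q"
  shows "cb p q P Q = - signed (p * q) (cb q p Q P)"
  unfolding cb_eq
  by (rule cup_skew[OF bracket_skew H_alternating[OF P] H_alternating[OF Q]]) (rule lin_alpha_pow)+

text \<open>The powers of \<open>\<alpha>\<close> are such that each of the three arguments receives one factor \<open>\<alpha>\<close> more in the outer than in the
  inner position; this is the Hom-Jacobi identity for \<open>X\<close>, \<open>Y\<close>, \<open>Z\<close> below.\<close>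
lemma cb_jacobi:
  assumes P: "P \<in> H p" and Q: "Q \<in> H q" and R: "R \<in> H r" and pos: "0 < p" "0 < q" "0 < r"
  shows "cb p (q + r) P (cb q r Q R) =
    cb (p + q) r (cb p q P Q) R + signed (p * q) (cb q (p + r) Q (cb p r P R))"
  unfolding cb_eq
proof (rule cup_jacobi)
  fix x y z
  define X Y Z where "X = (\<alpha> ^^ (q + r - 2)) x" and "Y = (\<alpha> ^^ (p + r - 2)) y"
    and "Z = (\<alpha> ^^ (p + q - 2)) z"
  have jac: "bracket (\<alpha> X) (bracket Y Z) = bracket (bracket X Y) (\<alpha> Z) + bracket (\<alpha> Y) (bracket X Z)"
    using hom_jacobi[of X Y Z] bracket_skew[of "bracket X Y" "\<alpha> Z"] bracket_skew[of Z X]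
      lin_minus[OF linear_right, of "\<alpha> Y" "bracket X Z"]
    by (simp add: algebra_simps)
  have x: "(\<alpha> ^^ (q + r - 1)) x = \<alpha> X" "(\<alpha> ^^ (r - 1)) ((\<alpha> ^^ (q - 1)) x) = X"
      "(\<alpha> ^^ (q - 1)) ((\<alpha> ^^ (r - 1)) x) = X"
    and y: "(\<alpha> ^^ (p - 1)) ((\<alpha> ^^ (r - 1)) y) = Y" "(\<alpha> ^^ (r - 1)) ((\<alpha> ^^ (p - 1)) y) = Y"
      "(\<alpha> ^^ (p + r - 1)) y = \<alpha> Y"
    and z: "(\<alpha> ^^ (p - 1)) ((\<alpha> ^^ (q - 1)) z) = Z" "(\<alpha> ^^ (q - 1)) ((\<alpha> ^^ (p - 1)) z) = Z"
      "(\<alpha> ^^ (p + q - 1)) z = \<alpha> Z"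
  proof -
    obtain p' q' r' where s: "p = Suc p'" "q = Suc q'" "r = Suc r'"
      using pos by (metis gr0_implies_Suc)
    show "(\<alpha> ^^ (q + r - 1)) x = \<alpha> X" "(\<alpha> ^^ (r - 1)) ((\<alpha> ^^ (q - 1)) x) = X"
      "(\<alpha> ^^ (q - 1)) ((\<alpha> ^^ (r - 1)) x) = X"
      "(\<alpha> ^^ (p - 1)) ((\<alpha> ^^ (r - 1)) y) = Y" "(\<alpha> ^^ (r - 1)) ((\<alpha> ^^ (p - 1)) y) = Y"
      "(\<alpha> ^^ (p + r - 1)) y = \<alpha> Y"
      "(\<alpha> ^^ (p - 1)) ((\<alpha> ^^ (q - 1)) z) = Z" "(\<alpha> ^^ (q - 1)) ((\<alpha> ^^ (p - 1)) z) = Z"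
      "(\<alpha> ^^ (p + q - 1)) z = \<alpha> Z"
      by (simp_all add: s X_def Y_def Z_def alpha_pow_add add.commute)
  qed
  show "bracket ((\<alpha> ^^ (q + r - 1)) x)
      ((\<alpha> ^^ (p - 1)) (bracket ((\<alpha> ^^ (r - 1)) y) ((\<alpha> ^^ (q - 1)) z))) =
    bracket ((\<alpha> ^^ (r - 1)) (bracket ((\<alpha> ^^ (q - 1)) x) ((\<alpha> ^^ (p - 1)) y)))
      ((\<alpha> ^^ (p + q - 1)) z) +
    bracket ((\<alpha> ^^ (p + r - 1)) y)
      ((\<alpha> ^^ (q - 1)) (bracket ((\<alpha> ^^ (r - 1)) x) ((\<alpha> ^^ (p - 1)) z)))"
    unfolding alpha_pow_bracket x y z by (rule jac)
qed (use P Q R in \<open>simp_all add: H_alternating lin_alpha_pow\<close>)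

lemma id_cochain_H: "id_cochain \<in> H 1"
  unfolding H_iff id_cochain_def
  by (auto intro!: alternatingI simp: lin_iff)

lemma ins_id_cochain: "P \<in> H p \<Longrightarrow> ins p 1 P id_cochain = P"
  by (simp add: ins_eq plug_m_1 fun_eq_iff) (simp add: id_cochain_def)

text \<open>The map \<open>\<theta>\<close> is an inner derivation of the cup bracket, up to sign.\<close>
lemma theta_eq: "th p P = - cb p 1 P id_cochain"
  unfolding theta_def insertion_def c_bracket_def bracket_cochain_def id_cochain_def
  by (simp add: fun_eq_iff One_nat_def)

lemma cb_zero [simp]: "cb p q 0 Q = 0" "cb p q P 0 = 0"
  by (simp_all add: cb_eq cup_zero_left cup_zero_right lin_alpha_pow)

lemma cb_linear:
  shows "cb p q (P + P') Q = cb p q P Q + cb p q P' Q"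
    and "cb p q P (Q + Q') = cb p q P Q + cb p q P Q'"
    and "cb p q (- P) Q = - cb p q P Q"
    and "cb p q P (- Q) = - cb p q P Q"
    and "cb p q (signed k P) Q = signed k (cb p q P Q)"
    and "cb p q P (signed k Q) = signed k (cb p q P Q)"
    and "cb p q (cochain_scale scale a P) Q = cochain_scale scale a (cb p q P Q)"
    and "cb p q P (cochain_scale scale a Q) = cochain_scale scale a (cb p q P Q)"
  by (simp_all only: cb_eq cup_add_left cup_add_right cup_minus_left cup_minus_right cup_signed_left
      cup_signed_right cochain_scale_def cup_scale_left cup_scale_right lin_alpha_pow)

lemma cb_diff: "cb p q (P - P') Q = cb p q P Q - cb p q P' Q"
    "cb p q P (Q - Q') = cb p q P Q - cb p q P Q'"
  using cb_linear(1)[of p q P "- P'" Q] cb_linear(2)[of p q P Q "- Q'"]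
  by (simp_all add: cb_linear(3,4))

lemma ins_linear_right:
  assumes "0 < q"
  shows "ins p q P (Q + Q') = ins p q P Q + ins p q P Q'"
    and "ins p q P (- Q) = - ins p q P Q"
    and "ins p q P (signed k Q) = signed k (ins p q P Q)"
    and "ins p q P (cochain_scale scale a Q) = cochain_scale scale a (ins p q P Q)"
  using assms
  by (simp_all only: ins_eq plug_add_right plug_minus_right plug_signed_right cochain_scale_def plug_scale_right)

lemma ins_linear_left:
  assumes "Q \<in> H q" "0 < q"
  shows "ins p q (P + P') Q = ins p q P Q + ins p q P' Q"
    and "ins p q (- P) Q = - ins p q P Q"
    and "ins p q (signed k P) Q = signed k (ins p q P Q)"
    and "ins p q (cochain_scale scale a P) Q = cochain_scale scale a (ins p q P Q)"
    and "ins p q 0 Q = 0"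
  using H_alternating[OF assms(1)] assms(2)
  by (simp_all only: ins_eq plug_add_left plug_minus_left plug_signed_left cochain_scale_def
      plug_scale_left plug_zero_left)

lemma ins_diff_right: "0 < q \<Longrightarrow> ins p q P (Q - Q') = ins p q P Q - ins p q P Q'"
  using ins_linear_right(1)[of q p P Q "- Q'"] by (simp add: ins_linear_right(2))

lemma ins_diff_left: "Q \<in> H q \<Longrightarrow> 0 < q \<Longrightarrow> ins p q (P - P') Q = ins p q P Q - ins p q P' Q"
  using ins_linear_left(1)[of Q q p P "- P'"] by (simp add: ins_linear_left(2))

lemma ins_zero_right: "ins p q P 0 = 0"
  by (simp add: insertion_def fun_eq_iff)

end

section \<open>The map theta and the derived bracket\<close>

context hom_lie_algebra
begin

lemma db_eq: "db p q P Q = cb p q P Q + ins (p + 1) q (th p P) Q - signed (p * q) (ins (q + 1) p (th q Q) P)"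
  by (simp add: derived_bracket_def cochain_scale_sign)

lemma nr_eq: "nr (p + 1) (q + 1) P Q =
    ins (p + 1) (q + 1) P Q - signed (p * q) (ins (q + 1) (p + 1) Q P)"
  by (simp add: nr_bracket_def cochain_scale_sign)

lemma theta_H: "P \<in> H p \<Longrightarrow> th p P \<in> H (p + 1)"
  unfolding theta_eq by (intro minus_H cb_H id_cochain_H)

lemma theta_linear:
  "th p (P + Q) = th p P + th p Q" "th p (P - Q) = th p P - th p Q" "th p (signed k P) = signed k (th p P)"
  "th p (cochain_scale scale a P) = cochain_scale scale a (th p P)" "th p 0 = 0"
  unfolding theta_eq
  by (simp_all add: cb_linear cb_diff signed_minus) (simp add: cochain_scale_def fun_eq_iff)

lemma db_H:
  assumes P: "P \<in> H p" and Q: "Q \<in> H q" and pos: "0 < p" "0 < q"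
  shows "db p q P Q \<in> H (p + q)"
proof -
  have "p + 1 + q - 1 = p + q" "q + 1 + p - 1 = p + q" by linarith+
  then show ?thesis
    using cb_H[OF P Q] ins_H[OF theta_H[OF P] Q pos(2)] ins_H[OF theta_H[OF Q] P pos(1)]
    unfolding db_eq by (intro diff_H add_H signed_H) (simp_all add: add.commute)
qed

text \<open>The Jacobi identity of the cup bracket, with the identity cochain as third entry.\<close>
lemma theta_cb:
  assumes P: "P \<in> H p" and Q: "Q \<in> H q" and pos: "0 < p" "0 < q"
  shows "th (p + q) (cb p q P Q) = cb p (q + 1) P (th q Q) - signed (p * q) (cb q (p + 1) Q (th p P))"
  using cb_jacobi[OF P Q id_cochain_H pos] by (simp add: theta_eq cb_linear signed_minus)

text \<open>Insertion is a derivation, and inserting \<open>A\<close> into the identity cochain gives \<open>A\<close> back.\<close>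
lemma ins_theta:
  assumes A: "A \<in> H (p + 1)" and Q: "Q \<in> H q" and pos: "0 < p" "0 < q"
  shows "ins (p + 1) (q + 1) A (th q Q) =
    th (p + q) (ins (p + 1) q A Q) - signed (p * q) (cb q (p + 1) Q A)"
proof -
  have "ins (p + 1) (q + 1) A (cb q 1 Q id_cochain) =
      cb (p + q) 1 (ins (p + 1) q A Q) id_cochain + signed (p * q) (cb q (p + 1) Q A)"
    using ins_derivation[OF A Q id_cochain_H] pos by (simp add: ins_id_cochain[OF A] signed_def)
  then show ?thesis by (simp add: theta_eq ins_linear_right)
qed

text \<open>Combining the two instances of \<open>ins_theta\<close>, the cup brackets of \<open>P\<close> with \<open>\<theta> Q\<close> and of \<open>Q\<close> with \<open>\<theta> P\<close> that are left
  over are those in \<open>theta_cb\<close>.\<close>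
lemma theta_db:
  assumes P: "P \<in> H p" and Q: "Q \<in> H q" and pos: "0 < p" "0 < q"
  shows "th (p + q) (db p q P Q) = nr (p + 1) (q + 1) (th p P) (th q Q)"
  using ins_theta[OF theta_H[OF P] Q pos] ins_theta[OF theta_H[OF Q] P pos(2,1)]
    theta_cb[OF P Q pos] cb_skew[OF P theta_H[OF Q]]
  by (simp add: db_eq nr_eq theta_linear signed_diff signed_signed add.commute[of q p] mult.commute[of q p])
    (simp add: signed_def)

end

section \<open>The Jacobi identity of the derived bracket\<close>

context hom_lie_algebra
begin

text \<open>The operator \<open>L\<^sub>P = i\<^bsub>\<theta> P\<^esub>\<close> of the post-Lie structure.\<close>
definition theta_act :: "nat \<Rightarrow> nat \<Rightarrow> 'v cochain \<Rightarrow> 'v cochain \<Rightarrow> 'v cochain" where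
  "theta_act p q P Q = ins (p + 1) q (th p P) Q"

lemma db_theta_act: "db p q P Q = cb p q P Q + theta_act p q P Q - signed (p * q) (theta_act q p Q P)"
  by (simp add: db_eq theta_act_def)

lemma theta_act_H:
  assumes "P \<in> H p" "Q \<in> H q" "0 < q"
  shows "theta_act p q P Q \<in> H (p + q)"
  using ins_H[OF theta_H[OF assms(1)] assms(2,3)] by (simp add: theta_act_def)

lemma theta_act_derivation:
  assumes "P \<in> H p" "Q \<in> H q" "R \<in> H r" "0 < p" "0 < q" "0 < r"
  shows "theta_act p (q + r) P (cb q r Q R) =
    cb (p + q) r (theta_act p q P Q) R + signed (p * q) (cb q (p + r) Q (theta_act p r P R))"
  using ins_derivation[OF theta_H[OF assms(1)] assms(2,3)] assms(4-6)
  by (simp add: theta_act_def signed_def)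

text \<open>\<open>L\<close> represents the derived bracket: \<open>\<theta>\<close> carries it to the commutator of insertion, and the pre-Lie
  identity makes insertion a representation of this commutator.\<close>
lemma theta_act_db:
  assumes P: "P \<in> H p" and Q: "Q \<in> H q" and R: "R \<in> H r" and pos: "0 < p" "0 < q" "0 < r"
  shows "theta_act (p + q) r (db p q P Q) R =
    theta_act p (q + r) P (theta_act q r Q R) - signed (p * q) (theta_act q (p + r) Q (theta_act p r P R))"
proof -
  have "theta_act (p + q) r (db p q P Q) R =
      ins (p + q + 1) r (ins (p + 1) (q + 1) (th p P) (th q Q)) R
      - signed (p * q) (ins (p + q + 1) r (ins (q + 1) (p + 1) (th q Q) (th p P)) R)"
    by (simp add: theta_act_def theta_db[OF P Q pos(1,2)] nr_eq ins_diff_left[OF R pos(3)]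
        ins_linear_left[OF R pos(3)])
  moreover have "ins (p + 1) (q + r) (th p P) (ins (q + 1) r (th q Q) R)
        - ins (p + q + 1) r (ins (p + 1) (q + 1) (th p P) (th q Q)) R =
      signed (p * q) (ins (q + 1) (p + r) (th q Q) (ins (p + 1) r (th p P) R)
        - ins (p + q + 1) r (ins (q + 1) (p + 1) (th q Q) (th p P)) R)"
    using ins_pre_lie[OF theta_H[OF P] theta_H[OF Q] R] pos
    by (simp add: signed_def add.assoc)
  moreover have "b - signed k d = a - signed k c" if "a - b = signed k (c - d)" for a b c d :: "'v cochain" and k
  proof -
    have "a = b + (signed k c - signed k d)" using that by (simp only: signed_diff diff_eq_eq add.commute)
    then show ?thesis by simp
  qed
  ultimately show ?thesis by (simp only: theta_act_def)
qed

lemma theta_act_linear_right: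
  assumes "0 < q"
  shows "theta_act p q P (Q + Q') = theta_act p q P Q + theta_act p q P Q'" "theta_act p q P (Q - Q') = theta_act p q P Q - theta_act p q P Q'"
    "theta_act p q P (signed k Q) = signed k (theta_act p q P Q)"
  using assms by (simp_all add: theta_act_def ins_linear_right ins_diff_right)

text \<open>Expand all brackets.  The derivation property of \<open>L\<close> distributes it over the cup bracket, \<open>theta_act_db\<close> removes
  derived brackets as indices of \<open>L\<close>, and antisymmetry brings the value of \<open>L\<close> to the second place of the cup
  bracket.  Then the terms cancel for each choice of parities.\<close>
lemma db_jacobi:
  assumes P: "P \<in> H p" and Q: "Q \<in> H q" and R: "R \<in> H r" and pos: "0 < p" "0 < q" "0 < r"
  shows "db p (q + r) P (db q r Q R) =
    db (p + q) r (db p q P Q) R + signed (p * q) (db q (p + r) Q (db p r P R))"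
proof -
  have pos': "0 < p + q" "0 < p + r" "0 < q + r" using pos by linarith+
  have skew: "cb (p + q) r (theta_act p q P Q) R = - signed ((p + q) * r) (cb r (p + q) R (theta_act p q P Q))"
    "cb (p + q) r (theta_act q p Q P) R = - signed ((p + q) * r) (cb r (p + q) R (theta_act q p Q P))"
    "cb (q + r) p (theta_act q r Q R) P = - signed ((q + r) * p) (cb p (q + r) P (theta_act q r Q R))"
    "cb (q + r) p (theta_act r q R Q) P = - signed ((q + r) * p) (cb p (q + r) P (theta_act r q R Q))"
    "cb (p + r) q (theta_act p r P R) Q = - signed ((p + r) * q) (cb q (p + r) Q (theta_act p r P R))"
    "cb (p + r) q (theta_act r p R P) Q = - signed ((p + r) * q) (cb q (p + r) Q (theta_act r p R P))"
    using theta_act_H[OF P Q pos(2)] theta_act_H[OF Q P pos(1)] theta_act_H[OF Q R pos(3)] theta_act_H[OF R Q pos(2)]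
      theta_act_H[OF P R pos(3)] theta_act_H[OF R P pos(1)]
    by (auto intro!: cb_skew P Q R simp: add.commute)
  have a: "q + p = p + q" "r + p = p + r" "r + q = q + r" by simp_all
  note D = theta_act_derivation[OF P Q R pos] theta_act_derivation[OF Q P R pos(2,1,3)]
    theta_act_derivation[OF R P Q pos(3,1,2)]
  note B = theta_act_db[OF P Q R pos] theta_act_db[OF P R Q pos(1,3,2)] theta_act_db[OF Q R P pos(2,3,1)]
  show ?thesis
    unfolding db_theta_act[of p "q + r" P] db_theta_act[of "p + q" r] db_theta_act[of q "p + r" Q] B[unfolded a]
    unfolding db_theta_act cb_linear cb_diff theta_act_linear_right[OF pos'(1)] theta_act_linear_right[OF pos'(2)]
      theta_act_linear_right[OF pos'(3)] D[unfolded a] cb_jacobi[OF P Q R pos] skew a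
    by (cases "even p"; cases "even q"; cases "even r"; simp add: signed_def algebra_simps)
qed

end

section \<open>The graded Lie algebra of the derived bracket\<close>

context hom_lie_algebra
begin

abbreviation "HC \<equiv> hom_complex scale \<alpha>"
abbreviation "HS \<equiv> hom_complex_shift scale \<alpha>"
abbreviation "cs \<equiv> cochain_scale scale"

text \<open>The lemmas so far concern arities at least 1.  In degree 0 the complex is zero, so what remains is
  that the operations vanish when an entry is 0.\<close>
lemma HC_cases:
  assumes "P \<in> HC p"
  obtains "p = 0" "P = 0" | "0 < p" "P \<in> H p"
  using assms by (cases "p = 0") (auto simp: hom_complex_def)

lemma HC_I: "P \<in> H p \<Longrightarrow> 0 < p \<Longrightarrow> P \<in> HC p"
  by (simp add: hom_complex_def)

lemma zero_HC: "0 \<in> HC n"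
  by (simp add: hom_complex_def zero_H del: zero_fun_apply)

lemma add_HC: "P \<in> HC p \<Longrightarrow> P' \<in> HC p \<Longrightarrow> P + P' \<in> HC p"
  using add_H by (auto simp: hom_complex_def)

lemma cs_HC: "P \<in> HC p \<Longrightarrow> cs c P \<in> HC p"
  using scale_H by (auto simp: hom_complex_def cochain_scale_def fun_eq_iff)

lemma signed_scale: "signed k (cs c P) = cs c (signed k P)"
  by (simp add: signed_def cochain_scale_def fun_eq_iff)

lemma cs_add: "cs c (P + Q) = cs c P + cs c Q"
  and cs_diff: "cs c (P - Q) = cs c P - cs c Q"
  by (simp_all add: cochain_scale_def scale_right_distrib scale_right_diff_distrib fun_eq_iff)

lemma ins_0_left: "Q \<in> HC q \<Longrightarrow> ins p q 0 Q = 0"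
  by (erule HC_cases) (simp_all only: ins_zero_right ins_linear_left)

lemma db_zero_left: "Q \<in> HC q \<Longrightarrow> db p q 0 Q = 0"
  by (simp add: db_eq theta_linear ins_0_left ins_zero_right)

lemma db_zero_right: "P \<in> HC p \<Longrightarrow> db p q P 0 = 0"
  by (simp add: db_eq theta_linear ins_0_left ins_zero_right)

lemma db_HC:
  assumes "P \<in> HC p" "Q \<in> HC q"
  shows "db p q P Q \<in> HC (p + q)"
  using assms(1)
proof (cases rule: HC_cases)
  case 1
  then show ?thesis using db_zero_left[OF assms(2)] zero_HC by simp
next
  case P: 2
  from assms(2) show ?thesis
  proof (cases rule: HC_cases)
    case 1
    then show ?thesis using db_zero_right[OF assms(1)] zero_HC by simp
  next
    case 2
    then show ?thesis using P db_H by (intro HC_I) simp_all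
  qed
qed

lemma db_skew:
  assumes "P \<in> HC p" "Q \<in> HC q"
  shows "db p q P Q = - signed (p * q) (db q p Q P)"
  using assms(1)
proof (cases rule: HC_cases)
  case 1
  then show ?thesis using db_zero_left[OF assms(2)] db_zero_right[OF assms(2)] by simp
next
  case P: 2
  from assms(2) show ?thesis
  proof (cases rule: HC_cases)
    case 1
    then show ?thesis using db_zero_left[OF assms(1)] db_zero_right[OF assms(1)] by simp
  next
    case 2
    then show ?thesis
      unfolding db_eq cb_skew[OF P(2) 2(2)] by (simp add: signed_def)
  qed
qed

lemma db_add_left:
  assumes "P \<in> HC p" "P' \<in> HC p" "Q \<in> HC q"
  shows "db p q (P + P') Q = db p q P Q + db p q P' Q"
  using assms(3)
proof (cases rule: HC_cases)
  case 1
  have "P + P' \<in> HC p" using assms(1,2) add_H by (auto simp: hom_complex_def)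
  then show ?thesis using 1 db_zero_right assms by simp
next
  case Q: 2
  from assms(1) show ?thesis
  proof (cases rule: HC_cases)
    case 1
    then show ?thesis using db_zero_left[OF assms(3)] by simp
  next
    case 2
    then show ?thesis
      unfolding db_eq theta_linear cb_linear ins_linear_left[OF Q(2,1)] ins_linear_right[OF 2(1)] signed_add
      by simp
  qed
qed

lemma db_scale_left:
  assumes "P \<in> HC p" "Q \<in> HC q"
  shows "db p q (cs c P) Q = cs c (db p q P Q)"
  using assms(2)
proof (cases rule: HC_cases)
  case 1
  have "cs c P \<in> HC p" "cs c 0 = 0"
    using assms(1) scale_H by (auto simp: hom_complex_def cochain_scale_def fun_eq_iff)
  then show ?thesis using 1 db_zero_right assms by simp
next
  case Q: 2
  have z: "cs c 0 = 0" by (simp add: cochain_scale_def fun_eq_iff)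
  from assms(1) show ?thesis
  proof (cases rule: HC_cases)
    case 1
    then show ?thesis using db_zero_left[OF assms(2)] z by simp
  next
    case 2
    then show ?thesis
      unfolding db_eq theta_linear cb_linear ins_linear_left[OF Q(2,1)] ins_linear_right[OF 2(1)]
        signed_scale cs_add cs_diff by simp
  qed
qed

lemma db_add_right:
  assumes "P \<in> HC p" "Q \<in> HC q" "Q' \<in> HC q"
  shows "db p q P (Q + Q') = db p q P Q + db p q P Q'"
  unfolding db_skew[OF assms(1) add_HC[OF assms(2,3)]] db_skew[OF assms(1,2)] db_skew[OF assms(1,3)]
    db_add_left[OF assms(2,3,1)] signed_add by simp

lemma db_scale_right:
  assumes "P \<in> HC p" "Q \<in> HC q"
  shows "db p q P (cs c Q) = cs c (db p q P Q)"
proof -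
  have "- cs c X = cs c (- X)" for X by (simp add: cochain_scale_def fun_eq_iff)
  then show ?thesis
    unfolding db_skew[OF assms(1) cs_HC[OF assms(2)]] db_skew[OF assms]
      db_scale_left[OF assms(2,1)] signed_scale by simp
qed

lemma db_jacobi_HC:
  assumes P: "P \<in> HC p" and Q: "Q \<in> HC q" and R: "R \<in> HC r"
  shows "db p (q + r) P (db q r Q R) =
    db (p + q) r (db p q P Q) R + signed (p * q) (db q (p + r) Q (db p r P R))"
proof (cases "p = 0 \<or> q = 0 \<or> r = 0")
  case True
  then have "P = 0 \<or> Q = 0 \<or> R = 0" using assms by (auto simp: hom_complex_def)
  then show ?thesis
    using db_zero_left[OF R] db_zero_right[OF P] db_zero_right[OF Q] db_zero_left[OF Q]
      db_zero_left[OF db_HC[OF Q R]] db_zero_left[OF db_HC[OF P R]] db_zero_right[OF db_HC[OF P Q]]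
    by auto
next
  case False
  then show ?thesis using assms by (intro db_jacobi) (auto simp: hom_complex_def)
qed

lemma vector_space_cs: "vector_space cs"
  by unfold_locales
    (simp_all add: cochain_scale_def fun_eq_iff scale_right_distrib scale_left_distrib)

lemma subspace_iff: "module.subspace cs S \<longleftrightarrow> 0 \<in> S \<and> (\<forall>f\<in>S. \<forall>g\<in>S. f + g \<in> S) \<and> (\<forall>c. \<forall>f\<in>S. cs c f \<in> S)"
  by (rule module.subspace_def) (use vector_space_cs in \<open>simp add: module_iff_vector_space\<close>)

lemma derived_graded_lie_algebra: "graded_lie_algebra cs HC db"
proof (intro graded_lie_algebra.intro graded_lie_algebra_axioms.intro)
  show "vector_space cs" by (rule vector_space_cs)
  show "module.subspace cs (HC n)" for n
    by (simp add: subspace_iff zero_HC add_HC cs_HC)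
qed (unfold cochain_scale_sign, (rule db_HC db_add_left db_add_right db_scale_left db_scale_right
    db_skew db_jacobi_HC; assumption)+)

end

section \<open>The graded Lie algebra of the Nijenhuis-Richardson bracket\<close>

context hom_lie_algebra
begin

text \<open>Insertion indexed by degree, which is the arity minus one.\<close>
definition pre_lie :: "nat \<Rightarrow> nat \<Rightarrow> 'v cochain \<Rightarrow> 'v cochain \<Rightarrow> 'v cochain" where
  "pre_lie p q = ins (p + 1) (q + 1)"

lemma pre_lie_identity:
  assumes P: "P \<in> HS p" and Q: "Q \<in> HS q" and R: "R \<in> HS r"
  shows "pre_lie (p + q) r (pre_lie p q P Q) R = pre_lie p (q + r) P (pre_lie q r Q R)
    - signed (p * q) (pre_lie q (p + r) Q (pre_lie p r P R) - pre_lie (p + q) r (pre_lie q p Q P) R)"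
proof -
  have "pre_lie p (q + r) P (pre_lie q r Q R) - pre_lie (p + q) r (pre_lie p q P Q) R =
    signed (p * q) (pre_lie q (p + r) Q (pre_lie p r P R) - pre_lie (p + q) r (pre_lie q p Q P) R)"
    using ins_pre_lie[of P "p + 1" Q "q + 1" R "r + 1"] assms
    by (simp add: pre_lie_def hom_complex_shift_def signed_def add.assoc)
  then show ?thesis by (simp add: algebra_simps)
qed

lemma pre_lie_HS: "P \<in> HS p \<Longrightarrow> Q \<in> HS q \<Longrightarrow> pre_lie p q P Q \<in> HS (p + q)"
  using ins_H[of P "p + 1" Q "q + 1"] by (simp add: pre_lie_def hom_complex_shift_def add.assoc)

lemma pre_lie_linear:
  "pre_lie p q P (X + Y) = pre_lie p q P X + pre_lie p q P Y" "pre_lie p q P (X - Y) = pre_lie p q P X - pre_lie p q P Y"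
  "pre_lie p q P (signed k X) = signed k (pre_lie p q P X)"  "pre_lie p q P (cs c X) = cs c (pre_lie p q P X)"
  by (simp_all add: pre_lie_def ins_linear_right ins_diff_right)

lemma pre_lie_linear_left:
  assumes "P \<in> HS q"
  shows "pre_lie p q (X + Y) P = pre_lie p q X P + pre_lie p q Y P" "pre_lie p q (X - Y) P = pre_lie p q X P - pre_lie p q Y P"
  "pre_lie p q (signed k X) P = signed k (pre_lie p q X P)" "pre_lie p q (cs c X) P = cs c (pre_lie p q X P)"
  using assms by (simp_all add: pre_lie_def hom_complex_shift_def ins_linear_left ins_diff_left)

lemma nr_commutator: "nr (p + 1) (q + 1) P Q = pre_lie p q P Q - signed (p * q) (pre_lie q p Q P)"
  unfolding nr_eq pre_lie_def ..

text \<open>The commutator of a graded pre-Lie product is a graded Lie bracket: the pre-Lie identity eliminates three of the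
  iterated products, and the remaining ones cancel for each choice of parities.\<close>
lemma nr_jacobi:
  assumes P: "P \<in> HS p" and Q: "Q \<in> HS q" and R: "R \<in> HS r"
  shows "nr (p + 1) (q + r + 1) P (nr (q + 1) (r + 1) Q R) =
    nr (p + q + 1) (r + 1) (nr (p + 1) (q + 1) P Q) R
    + signed (p * q) (nr (q + 1) (p + r + 1) Q (nr (p + 1) (r + 1) P R))"
proof -
  have a: "q + p = p + q" "r + p = p + r" "r + q = q + r" by simp_all
  show ?thesis
    unfolding nr_commutator pre_lie_linear pre_lie_linear_left[OF P] pre_lie_linear_left[OF Q] pre_lie_linear_left[OF R] a
      pre_lie_identity[OF P Q R] pre_lie_identity[OF P R Q, unfolded a] pre_lie_identity[OF Q R P, unfolded a]
    by (cases "even p"; cases "even q"; cases "even r"; simp add: signed_def algebra_simps)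
qed

lemma HS_closed: "0 \<in> HS n" "P \<in> HS n \<Longrightarrow> Q \<in> HS n \<Longrightarrow> P + Q \<in> HS n" "P \<in> HS n \<Longrightarrow> cs c P \<in> HS n"
   "P \<in> HS n \<Longrightarrow> Q \<in> HS n \<Longrightarrow> P - Q \<in> HS n" "P \<in> HS n \<Longrightarrow> signed k P \<in> HS n"
  by (simp_all only: hom_complex_shift_def zero_H add_H scale_H diff_H signed_H)

lemma nr_graded_lie_algebra: "graded_lie_algebra cs HS (\<lambda>m n. nr (m + 1) (n + 1))"
proof (intro graded_lie_algebra.intro graded_lie_algebra_axioms.intro)
  show "vector_space cs" by (rule vector_space_cs)
  show "module.subspace cs (HS n)" for n
    by (simp add: subspace_iff HS_closed)
  fix P Q m n assume PQ: "P \<in> HS m" "Q \<in> HS n"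
  show "nr (m + 1) (n + 1) P Q \<in> HS (m + n)"
    unfolding nr_commutator using pre_lie_HS[OF PQ] pre_lie_HS[OF PQ(2,1)]
    by (intro HS_closed) (simp_all add: add.commute)
  show "nr (m + 1) (n + 1) P Q = - cs ((-1) ^ (m * n)) (nr (n + 1) (m + 1) Q P)"
    unfolding nr_commutator cochain_scale_sign by (simp add: signed_def)
  show "nr (m + 1) (n + 1) (cs c P) Q = cs c (nr (m + 1) (n + 1) P Q)" 
       "nr (m + 1) (n + 1) P (cs c Q) = cs c (nr (m + 1) (n + 1) P Q)" for c
    unfolding nr_commutator pre_lie_linear pre_lie_linear_left[OF PQ(1)] pre_lie_linear_left[OF PQ(2)] signed_scale cs_diff by simp_all
  show "nr (m + 1) (n + 1) (P + P') Q = nr (m + 1) (n + 1) P Q + nr (m + 1) (n + 1) P' Q" for P'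
    unfolding nr_commutator pre_lie_linear pre_lie_linear_left[OF PQ(2)] signed_add by simp
  show "nr (m + 1) (n + 1) P (Q + Q') = nr (m + 1) (n + 1) P Q + nr (m + 1) (n + 1) P Q'" for Q'
    unfolding nr_commutator pre_lie_linear pre_lie_linear_left[OF PQ(1)] signed_add by simp
next
  fix P Q R p q r assume "P \<in> HS p" "Q \<in> HS q" "R \<in> HS r"
  then show "nr (p + 1) (q + r + 1) P (nr (q + 1) (r + 1) Q R) =
    nr (p + q + 1) (r + 1) (nr (p + 1) (q + 1) P Q) R
    + cs ((-1) ^ (p * q)) (nr (q + 1) (p + r + 1) Q (nr (p + 1) (r + 1) P R))"
    unfolding cochain_scale_sign by (rule nr_jacobi)
qed

end

section \<open>The morphism\<close>

context hom_lie_algebra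
begin

lemma theta_HS: "P \<in> HC p \<Longrightarrow> th p P \<in> HS p"
  by (erule HC_cases) (simp_all only: hom_complex_shift_def theta_linear zero_H theta_H)

lemma theta_db_HC:
  assumes P: "P \<in> HC p" and Q: "Q \<in> HC q"
  shows "th (p + q) (db p q P Q) = nr (p + 1) (q + 1) (th p P) (th q Q)"
proof (cases "p = 0 \<or> q = 0")
  case True
  have zero: "nr (p + 1) (q + 1) 0 (th q Q) = 0" "nr (p + 1) (q + 1) (th p P) 0 = 0"
    using theta_HS[OF P] theta_HS[OF Q]
    by (simp_all add: nr_eq hom_complex_shift_def ins_linear_left ins_zero_right)
  from True have "P = 0 \<or> Q = 0" using assms by (auto simp: hom_complex_def)
  then show ?thesis
    using db_zero_left[OF Q] db_zero_right[OF P] zero by (auto simp: theta_linear)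
next
  case False
  then show ?thesis using assms by (intro theta_db) (auto simp: hom_complex_def)
qed

lemma theta_morphism:
  "graded_lie_morphism cs HC db cs HS (\<lambda>m n. nr (m + 1) (n + 1)) th"
  by (intro graded_lie_morphism.intro graded_lie_morphism_axioms.intro
      derived_graded_lie_algebra nr_graded_lie_algebra theta_HS theta_linear theta_db_HC)

end

theorem theorem5p3:
  fixes scale :: "'k::field_char_0 \<Rightarrow> 'v::ab_group_add \<Rightarrow> 'v"
    and bracket :: "'v \<Rightarrow> 'v \<Rightarrow> 'v" and \<alpha> :: "'v \<Rightarrow> 'v"
  assumes "hom_lie_algebra scale bracket \<alpha>"
  shows "graded_lie_algebra (cochain_scale scale)
           (hom_complex scale \<alpha>) (derived_bracket scale bracket \<alpha>) \<and>
         graded_lie_morphism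
           (cochain_scale scale) (hom_complex scale \<alpha>) (derived_bracket scale bracket \<alpha>)
           (cochain_scale scale) (hom_complex_shift scale \<alpha>)
             (\<lambda>m n. nr_bracket scale \<alpha> (m + 1) (n + 1))
           (theta scale bracket \<alpha>)"
proof -
  interpret hom_lie_algebra scale bracket \<alpha> by (rule assms)
  show ?thesis using derived_graded_lie_algebra theta_morphism by blast
qed

end
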